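(* Let $d\ge 2$ be fixed. There is an infinite set $\mathbb{E}$ of positive integers such that $$\lim_{k\to\infty}\frac{|\mathbb{E}\cap[1,k]|}{k^{1/(d-1)}}=0,$$ such that $\delta_z(d,k)=\lfloor\lambda(d,k)\rfloor$ for every positive integer $k\notin\mathbb{E}$, and $\delta_z(d,k)=\lfloor\lambda(d,k)\rfloor-1$ for every $k\in\mathbb{E}$.
   Context: A point of $\mathbb{Z}^d$ is primitive if its coordinates are relatively prime; $\mathbb{P}^d_\circ$ denotes the set of primitive points of $\mathbb{Z}^d$ whose first non-zero coordinate is positive. For a finite $\mathcal{X}\subset\mathbb{R}^d$, $\kappa(\mathcal{X})=\max_{1\le i\le d}\sum_{x\in\mathcal{X}}|x_i|$. For a positive integer $k$, $\delta_z(d,k)=\max\{|\mathcal{X}|:\mathcal{X}\subset\mathbb{P}^d_\circ,\ \kappa(\mathcal{X})\le k\}$. Let $B(d,p)=\{x\in\mathbb{R}^d:\|x\|_1\le p\}$, and for integers $p\ge 0$ let $N_p=|B(d,p)\cap\mathbb{P}^d_\circ|$ and $\kappa_p=\kappa(B(d,p)\cap\mathbb{P}^d_\circ)$ (so $N_0=\kappa_0=0$). For a positive integer $k$, let $p$ be the smallest positive integer with $k<\kappa_p$ and set $\lambda(d,k)=N_{p-1}+\frac{d\,(k-\kappa_{p-1})}{p}$; this is the piecewise-linear interpolation of the points $(\kappa_p,N_p)$. *)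

theory Defs
  imports "HOL-Analysis.Analysis"
begin

definition prim_pos :: "nat \<Rightarrow> int list set" where
  "prim_pos d = {x. length x = d \<and> Gcd (set x) = 1 \<and>
      (\<exists>i<d. x ! i > 0 \<and> (\<forall>j<i. x ! j = 0))}"

definition kappa :: "nat \<Rightarrow> int list set \<Rightarrow> int" where
  "kappa d X = Max ((\<lambda>i. \<Sum>x\<in>X. \<bar>x ! i\<bar>) ` {..<d})"

definition delta_z :: "nat \<Rightarrow> nat \<Rightarrow> nat" where
  "delta_z d k = Max {card X | X. finite X \<and> X \<subseteq> prim_pos d \<and> kappa d X \<le> int k}"

definition ball_prim :: "nat \<Rightarrow> nat \<Rightarrow> int list set" where
  "ball_prim d p = {x \<in> prim_pos d. (\<Sum>i<d. \<bar>x ! i\<bar>) \<le> int p}"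

definition N_p :: "nat \<Rightarrow> nat \<Rightarrow> nat" where
  "N_p d p = card (ball_prim d p)"

definition kappa_p :: "nat \<Rightarrow> nat \<Rightarrow> int" where
  "kappa_p d p = kappa d (ball_prim d p)"

definition lambda_dk :: "nat \<Rightarrow> nat \<Rightarrow> real" where
  "lambda_dk d k = (let p = (LEAST p. p > 0 \<and> int k < kappa_p d p) in
      real (N_p d (p - 1)) + real d * (real_of_int (int k - kappa_p d (p - 1))) / real p)"

end

theory Submission
  imports Defs
begin

text \<open>
  Let \<open>p\<close> be the least level with \<open>k < \<kappa>\<^sub>p\<close>, put \<open>m = k - \<kappa>\<^bsub>p-1\<^esub>\<close> and
  \<open>n = \<lfloor>d m / p\<rfloor>\<close>, so that \<open>\<lfloor>\<lambda>(d,k)\<rfloor> = N\<^bsub>p-1\<^esub> + n\<close>. Comparing a packing with the ball of radius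
  \<open>p - 1\<close> through the sum of \<open>\<parallel>x\<parallel>\<^sub>1 - p\<close> gives the upper bound. For the lower bound one adds to this
  ball \<open>n\<close> points of norm \<open>p\<close>. Orbits under the cyclic rotation of coordinates are perfectly balanced
  and have at most \<open>d\<close> elements, so it suffices to complete a union of orbits by fewer than about \<open>d\<close>
  points whose coordinates are nearly equal. If \<open>d\<close> does not divide \<open>p\<close>, this succeeds for all \<open>k\<close>.
  If \<open>p = q d\<close>, it succeeds except possibly when \<open>m mod q \<in> {0, 1}\<close>, and it always succeeds with
  \<open>n - 1\<close> points. For \<open>d \<ge> 3\<close> perturbations of \<open>(q,\<dots>,q)\<close> by vectors \<open>e\<^sub>a - e\<^sub>b\<close> form
  exactly balanced sets of all small sizes at least \<open>2\<close>, which leaves boundedly many exceptions for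
  each \<open>p\<close>. For \<open>d = 2\<close> each value of \<open>\<delta>\<^sub>z\<close> is taken by at most two exceptions, and
  \<open>\<delta>\<^sub>z\<close> grows sublinearly. Finally \<open>m = q \<ge> 2\<close> is always an exception, since the single
  added point would have to be \<open>(\<plusminus>q,\<dots>,\<plusminus>q)\<close>.
\<close>

section \<open>Column sums and two arithmetic facts\<close>

definition col_sum :: "nat \<Rightarrow> int list set \<Rightarrow> int" where
  "col_sum i X = (\<Sum>x\<in>X. \<bar>x ! i\<bar>)"

lemma col_sum_union: "finite X \<Longrightarrow> finite Y \<Longrightarrow> X \<inter> Y = {} \<Longrightarrow> col_sum i (X \<union> Y) = col_sum i X + col_sum i Y"
  by (simp add: col_sum_def sum.union_disjoint)

lemma col_sum_mono: "finite Y \<Longrightarrow> X \<subseteq> Y \<Longrightarrow> col_sum i X \<le> col_sum i Y"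
  by (simp add: col_sum_def sum_mono2)

lemma Gcd_coprime:
  fixes a b :: int
  assumes "a \<in> A" "b \<in> A" "coprime a b"
  shows "Gcd A = 1"
  using assms by (metis Gcd_dvd Gcd_int_greater_eq_0 coprime_common_divisor_int zdvd1_eq abs_of_nonneg)

text \<open>By Pascal's rule each step adds a binomial coefficient that is at least 1. The bound
  later provides \<open>d\<close> points of a layer whose coordinates differ by at most 1.\<close>

lemma le_binomial:
  assumes "0 < r" "r < n" shows "n \<le> n choose r"
  using assms
proof (induction n arbitrary: r)
  case (Suc n)
  then obtain s where s: "r = Suc s" by (cases r) auto
  show ?case
  proof (cases "r = n")
    case True
    then show ?thesis by simp
  next
    case False
    then have "n \<le> n choose r" using Suc by simp
    moreover have "1 \<le> n choose s" using Suc.prems s by (simp add: Suc_le_eq)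
    ultimately show ?thesis by (simp add: s)
  qed
qed simp

section \<open>Primitive points, balls and layers in a fixed dimension\<close>

locale dimension =
  fixes d :: nat
  assumes d2: "2 \<le> d"
begin

definition norm1 :: "int list \<Rightarrow> int" where
  "norm1 x = (\<Sum>i<d. \<bar>x ! i\<bar>)"

definition layer :: "nat \<Rightarrow> int list set" where
  "layer p = {x \<in> prim_pos d. norm1 x = int p}"

lemma kappa_le_iff: "kappa d X \<le> k \<longleftrightarrow> (\<forall>i<d. col_sum i X \<le> k)"
  using d2 by (auto simp: kappa_def col_sum_def Max_le_iff lessThan_empty_iff)

lemma sum_col_sum: "(\<Sum>i<d. col_sum i X) = (\<Sum>x\<in>X. norm1 x)"
  unfolding col_sum_def norm1_def by (rule sum.swap)

lemma prim_posD: "x \<in> prim_pos d \<Longrightarrow> length x = d" "x \<in> prim_pos d \<Longrightarrow> Gcd (set x) = 1"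
  by (auto simp: prim_pos_def)

lemma ball_prim_eq: "ball_prim d p = {x \<in> prim_pos d. norm1 x \<le> int p}"
  by (simp add: ball_prim_def norm1_def)

lemma abs_nth_le_norm1: "i < d \<Longrightarrow> \<bar>x ! i\<bar> \<le> norm1 x"
  unfolding norm1_def by (rule member_le_sum) auto

lemma finite_ball: "finite (ball_prim d p)"
proof (rule finite_subset)
  show "ball_prim d p \<subseteq> {x. set x \<subseteq> {- int p..int p} \<and> length x = d}"
  proof safe
    fix x a assume x: "x \<in> ball_prim d p" and "a \<in> set x"
    then obtain i where "i < d" "a = x ! i"
      using prim_posD(1)[of x] by (auto simp: ball_prim_eq in_set_conv_nth)
    then have "\<bar>a\<bar> \<le> int p"
      using abs_nth_le_norm1[of i x] x by (auto simp: ball_prim_eq)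
    then show "a \<in> {- int p..int p}" by auto
  qed (auto simp: ball_prim_eq prim_posD)
  show "finite {x. set x \<subseteq> {- int p..int p} \<and> length x = d}"
    by (rule finite_lists_length_eq) auto
qed

lemma layer_subset_ball: "layer p \<subseteq> ball_prim d p"
  by (auto simp: layer_def ball_prim_eq)

lemma finite_layer: "finite (layer p)"
  using finite_subset[OF layer_subset_ball finite_ball] .

lemma ball_split: "1 \<le> p \<Longrightarrow> ball_prim d p = ball_prim d (p - 1) \<union> layer p"
  by (auto simp: layer_def ball_prim_eq)

lemma ball_layer_disjoint: "1 \<le> p \<Longrightarrow> ball_prim d (p - 1) \<inter> layer p = {}"
  by (auto simp: layer_def ball_prim_eq)

lemma N_p_split: "1 \<le> p \<Longrightarrow> N_p d p = N_p d (p - 1) + card (layer p)"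
  unfolding N_p_def ball_split[of p]
  by (rule card_Un_disjoint) (use ball_layer_disjoint[of p] in \<open>auto simp: finite_ball finite_layer\<close>)

lemma prim_posI_pos:
  assumes "length x = d" "Gcd (set x) = 1" "0 < x ! 0"
  shows "x \<in> prim_pos d"
  using assms d2 unfolding prim_pos_def by fastforce

lemma Gcd_nonzero:
  assumes "length x = d" "Gcd (set x) = (1::int)"
  shows "\<exists>i<d. x ! i \<noteq> 0"
proof (rule ccontr)
  assume "\<not> ?thesis"
  then have "set x \<subseteq> {0}" using assms(1) by (auto simp: in_set_conv_nth)
  then have "Gcd (set x) = 0" by (simp add: Gcd_0_iff)
  with assms(2) show False by simp
qed

lemma least_nonzero:
  assumes "length x = d" "Gcd (set x) = (1::int)"
  obtains i where "i < d" "x ! i \<noteq> 0" "\<forall>j<i. x ! j = 0"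
proof -
  let ?i = "LEAST i. i < d \<and> x ! i \<noteq> 0"
  have 1: "?i < d \<and> x ! ?i \<noteq> 0"
    using Gcd_nonzero[OF assms] by (rule LeastI_ex)
  have "\<forall>j<?i. x ! j = 0"
    using 1 not_less_Least[of _ "\<lambda>i. i < d \<and> x ! i \<noteq> 0"] by (meson less_trans)
  with 1 that show ?thesis by blast
qed

lemma prim_posI_nonneg:
  assumes "length x = d" "Gcd (set x) = 1" "\<And>i. i < d \<Longrightarrow> 0 \<le> x ! i"
  shows "x \<in> prim_pos d"
proof -
  obtain i where i: "i < d" "x ! i \<noteq> 0" "\<forall>j<i. x ! j = 0"
    using least_nonzero[OF assms(1,2)] by blast
  then have "0 < x ! i" using assms(3)[of i] by simp
  then show ?thesis using i assms(1,2) by (auto simp: prim_pos_def)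
qed

subsection \<open>Coordinate permutations and rotation orbits\<close>

definition perm_vec :: "int \<Rightarrow> (nat \<Rightarrow> nat) \<Rightarrow> int list \<Rightarrow> int list" where
  "perm_vec c \<pi> x = map (\<lambda>i. c * x ! \<pi> i) [0..<d]"

text \<open>Permuting coordinates can make the first non-zero entry negative; the sign is then
  reversed, so permutations act on primitive points taken up to sign.\<close>

definition act :: "(nat \<Rightarrow> nat) \<Rightarrow> int list \<Rightarrow> int list" where
  "act \<pi> x = (if perm_vec 1 \<pi> x \<in> prim_pos d then perm_vec 1 \<pi> x else perm_vec (- 1) \<pi> x)"

lemma length_perm_vec [simp]: "length (perm_vec c \<pi> x) = d"
  and nth_perm_vec [simp]: "i < d \<Longrightarrow> perm_vec c \<pi> x ! i = c * x ! \<pi> i"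
  by (auto simp: perm_vec_def)

lemma act_cases:
  obtains c where "c = 1 \<or> c = -1" "act \<pi> x = perm_vec c \<pi> x"
  unfolding act_def by metis

lemma Gcd_perm_vec:
  assumes "bij_betw \<pi> {..<d} {..<d}" "length x = d" "c = 1 \<or> c = - 1"
  shows "Gcd (set (perm_vec c \<pi> x)) = Gcd (set x)"
proof -
  have "set (perm_vec c \<pi> x) = (\<lambda>i. c * x ! i) ` \<pi> ` {..<d}"
    by (auto simp: perm_vec_def)
  also have "\<pi> ` {..<d} = {..<d}"
    using assms(1) by (simp add: bij_betw_def)
  also have "(\<lambda>i. c * x ! i) ` {..<d} = (*) c ` set x"
    using assms(2) by (auto simp: set_conv_nth)
  also have "Gcd \<dots> = normalize (c * Gcd (set x))"
    by (rule Gcd_mult)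
  also have "\<dots> = Gcd (set x)"
    using assms(3) by auto
  finally show ?thesis .
qed

lemma act_prim_pos:
  assumes "bij_betw \<pi> {..<d} {..<d}" "x \<in> prim_pos d"
  shows "act \<pi> x \<in> prim_pos d"
proof (cases "perm_vec 1 \<pi> x \<in> prim_pos d")
  case False
  have g: "Gcd (set (perm_vec c \<pi> x)) = 1" if "c = 1 \<or> c = -1" for c
    using Gcd_perm_vec[OF assms(1) prim_posD(1)[OF assms(2)] that] prim_posD(2)[OF assms(2)] by simp
  obtain i where i: "i < d" "perm_vec 1 \<pi> x ! i \<noteq> 0" "\<forall>j<i. perm_vec 1 \<pi> x ! j = 0"
    using least_nonzero[OF length_perm_vec g] by blast
  have "\<not> 0 < perm_vec 1 \<pi> x ! i"
    using False i g[of 1] unfolding prim_pos_def by (simp del: nth_perm_vec) blast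
  then have "perm_vec (- 1) \<pi> x \<in> prim_pos d"
    using i g[of "-1"] by (auto simp: prim_pos_def intro!: exI[of _ i])
  then show ?thesis using False by (simp add: act_def)
qed (simp add: act_def)

lemma length_act [simp]: "length (act \<pi> x) = d"
  by (simp add: act_def)

lemma abs_act: "i < d \<Longrightarrow> \<bar>act \<pi> x ! i\<bar> = \<bar>x ! \<pi> i\<bar>"
  by (simp add: act_def)

lemma norm1_act: "bij_betw \<pi> {..<d} {..<d} \<Longrightarrow> norm1 (act \<pi> x) = norm1 x"
  unfolding norm1_def using sum.reindex_bij_betw[of \<pi> "{..<d}" "{..<d}" "\<lambda>i. \<bar>x ! i\<bar>"]
  by (simp add: abs_act)

lemma act_layer: "bij_betw \<pi> {..<d} {..<d} \<Longrightarrow> x \<in> layer p \<Longrightarrow> act \<pi> x \<in> layer p"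
  by (simp add: layer_def act_prim_pos norm1_act)

lemma act_ball: "bij_betw \<pi> {..<d} {..<d} \<Longrightarrow> x \<in> ball_prim d p \<Longrightarrow> act \<pi> x \<in> ball_prim d p"
  by (simp add: ball_prim_eq act_prim_pos norm1_act)

text \<open>A vector and its negative cannot both have a positive first non-zero coordinate. This
  turns identities known only up to sign into equalities.\<close>

lemma prim_pos_sign_unique:
  assumes "x \<in> prim_pos d" "y \<in> prim_pos d" "c = 1 \<or> c = -1" "\<And>i. i < d \<Longrightarrow> y ! i = c * x ! i"
  shows "x = y"
proof -
  have "c = 1"
  proof (rule ccontr)
    assume "c \<noteq> 1"
    then have y: "y ! i = - x ! i" if "i < d" for i using assms(3,4) that by auto
    obtain i j where "i < d" "0 < x ! i" "\<forall>k<i. x ! k = 0" "j < d" "0 < y ! j" "\<forall>k<j. y ! k = 0"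
      using assms(1,2) by (auto simp: prim_pos_def)
    then show False using y
      by (cases i j rule: linorder_cases) auto
  qed
  then show ?thesis using assms by (auto intro!: nth_equalityI simp: prim_posD)
qed

lemma act_inj:
  assumes \<pi>: "bij_betw \<pi> {..<d} {..<d}" shows "inj_on (act \<pi>) (prim_pos d)"
proof (rule inj_onI)
  fix x y assume x: "x \<in> prim_pos d" and y: "y \<in> prim_pos d" and e: "act \<pi> x = act \<pi> y"
  obtain a where a: "a = 1 \<or> a = -1" "act \<pi> x = perm_vec a \<pi> x" by (rule act_cases)
  obtain b where b: "b = 1 \<or> b = -1" "act \<pi> y = perm_vec b \<pi> y" by (rule act_cases)
  show "x = y"
  proof (rule prim_pos_sign_unique[OF x y, of "a * b"])
    fix i assume "i < d"
    then have "i \<in> \<pi> ` {..<d}" using \<pi> by (simp add: bij_betw_def)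
    then obtain j where "j < d" "\<pi> j = i" by auto
    then have "a * x ! i = b * y ! i" using e a(2) b(2) nth_perm_vec[of j a \<pi> x] nth_perm_vec[of j b \<pi> y] by simp
    then show "y ! i = a * b * x ! i" using a b by auto
  qed (use a b in auto)
qed

text \<open>Each application of \<open>act\<close> may reverse the sign, so only some sign
  \<open>c\<close> is recorded; \<open>prim_pos_sign_unique\<close> removes it once the permutation
  returns to the identity.\<close>

lemma funpow_act:
  assumes "bij_betw \<pi> {..<d} {..<d}" "x \<in> prim_pos d"
  shows "(act \<pi> ^^ n) x \<in> prim_pos d \<and>
    (\<exists>c. (c = 1 \<or> c = -1) \<and> (\<forall>i<d. (act \<pi> ^^ n) x ! i = c * x ! ((\<pi> ^^ n) i)))"
proof (induction n)
  case 0
  then show ?case using assms by (auto intro: exI[of _ 1])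
next
  case (Suc n)
  then obtain c where c: "c = 1 \<or> c = -1" "\<forall>i<d. (act \<pi> ^^ n) x ! i = c * x ! ((\<pi> ^^ n) i)" by blast
  obtain b where b: "b = 1 \<or> b = -1" "act \<pi> ((act \<pi> ^^ n) x) = perm_vec b \<pi> ((act \<pi> ^^ n) x)"
    by (rule act_cases)
  have "\<pi> i < d" if "i < d" for i using assms(1) that by (auto simp: bij_betw_def)
  then have "\<forall>i<d. (act \<pi> ^^ Suc n) x ! i = (b * c) * x ! ((\<pi> ^^ Suc n) i)"
    using b c by (simp add: funpow_swap1)
  moreover have "b * c = 1 \<or> b * c = -1" using b c by auto
  ultimately show ?case using Suc act_prim_pos[OF assms(1)] by auto
qed

lemma funpow_act_id:
  assumes "bij_betw \<pi> {..<d} {..<d}" "x \<in> prim_pos d" "\<And>i. i < d \<Longrightarrow> (\<pi> ^^ n) i = i"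
  shows "(act \<pi> ^^ n) x = x"
proof -
  obtain c where c: "c = 1 \<or> c = -1" "\<forall>i<d. (act \<pi> ^^ n) x ! i = c * x ! ((\<pi> ^^ n) i)"
    using funpow_act[OF assms(1,2)] by blast
  have "x = (act \<pi> ^^ n) x"
    by (rule prim_pos_sign_unique[of _ _ c]) (use c assms funpow_act[OF assms(1,2)] in auto)
  then show ?thesis by simp
qed

definition shift :: "nat \<Rightarrow> nat" where
  "shift i = (i + 1) mod d"

lemma funpow_shift: "i < d \<Longrightarrow> (shift ^^ n) i = (i + n) mod d"
  by (induction n) (auto simp: shift_def mod_Suc_eq)

lemma bij_shift: "bij_betw shift {..<d} {..<d}"
proof (rule bij_betw_imageI)
  show inj: "inj_on shift {..<d}"
  proof (rule inj_onI)
    fix i j assume ij: "i \<in> {..<d}" "j \<in> {..<d}" "shift i = shift j"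
    \<comment> \<open>The power \<open>d - 1\<close> of the shift is its inverse.\<close>
    have r: "(shift ^^ (d - 1)) (shift i) = i" if "i < d" for i
    proof -
      have "(shift ^^ (d - 1)) (shift i) = (shift ^^ d) i"
        using d2 funpow_swap1[of shift "d - 1" i] by (cases d) auto
      then show ?thesis using that by (simp add: funpow_shift)
    qed
    show "i = j" using r[of i, symmetric] r[of j] ij(1,2) unfolding ij(3) by simp
  qed
  show "shift ` {..<d} = {..<d}"
    by (rule endo_inj_surj) (use inj d2 in \<open>auto simp: shift_def\<close>)
qed

abbreviation rotate_coords :: "int list \<Rightarrow> int list" where
  "rotate_coords \<equiv> act shift"

text \<open>These are the finite unions of rotation orbits: rotation is injective on primitive
  points, so on a finite set the inclusion is an equality.\<close>

definition rot_closed :: "int list set \<Rightarrow> bool" where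
  "rot_closed X \<longleftrightarrow> finite X \<and> X \<subseteq> prim_pos d \<and> rotate_coords ` X \<subseteq> X"

text \<open>Rotation permutes \<open>X\<close> and carries each column to the next one, so all
  columns have the same sum, which is the total norm divided by \<open>d\<close>.\<close>

lemma rot_closed_col_sum:
  assumes "rot_closed X" "i < d"
  shows "int d * col_sum i X = (\<Sum>x\<in>X. norm1 x)"
proof -
  have inj: "inj_on rotate_coords X"
    using assms inj_on_subset[OF act_inj[OF bij_shift]] by (auto simp: rot_closed_def)
  have X: "rotate_coords ` X = X"
    using assms inj by (intro endo_inj_surj) (auto simp: rot_closed_def)
  have step: "col_sum (shift j) X = col_sum j X" if "j < d" for j
  proof -
    have "col_sum j X = (\<Sum>x\<in>rotate_coords ` X. \<bar>x ! j\<bar>)" by (simp add: col_sum_def X)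
    also have "\<dots> = (\<Sum>x\<in>X. \<bar>rotate_coords x ! j\<bar>)" using inj by (simp add: sum.reindex)
    also have "\<dots> = col_sum (shift j) X" using that by (simp add: abs_act col_sum_def)
    finally show ?thesis by simp
  qed
  have "col_sum j X = col_sum 0 X" if "j < d" for j
    using that
  proof (induction j)
    case (Suc j)
    then have "shift j = Suc j" by (simp add: shift_def)
    then show ?case using step[of j] Suc by simp
  qed simp
  then have "col_sum j X = col_sum i X" if "j < d" for j
    using that assms(2) by metis
  then have "(\<Sum>j<d. col_sum j X) = (\<Sum>j<d. col_sum i X)"
    by (intro sum.cong) auto
  then show ?thesis by (simp add: sum_col_sum)
qed

text \<open>After \<open>d\<close> rotations the point itself returns, sign included. Repetitions
  may occur earlier, so the orbit has at most \<open>d\<close> elements.\<close>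

lemma rot_closed_orbit:
  assumes "x \<in> prim_pos d"
  shows "rot_closed ((\<lambda>n. (rotate_coords ^^ n) x) ` {..<d})" (is "rot_closed ?O")
proof -
  have id: "(rotate_coords ^^ d) x = x"
    by (rule funpow_act_id[OF bij_shift assms]) (simp add: funpow_shift)
  have "rotate_coords ((rotate_coords ^^ n) x) \<in> ?O" if "n < d" for n
  proof (cases "Suc n < d")
    case True
    then show ?thesis by (intro image_eqI[of _ _ "Suc n"]) auto
  next
    case False
    then have "Suc n = d" using that by simp
    then have "rotate_coords ((rotate_coords ^^ n) x) = (rotate_coords ^^ 0) x" using id by auto
    then show ?thesis using d2 by (intro image_eqI[of _ _ 0]) auto
  qed
  then show ?thesis using funpow_act[OF bij_shift assms] by (auto simp: rot_closed_def)
qed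

text \<open>Take a rotation-closed subset of largest size at most \<open>t\<close>. If a point is
  left over, adding its orbit of at most \<open>d\<close> elements must exceed
  \<open>t\<close>.\<close>

lemma rot_closed_subset_of_size:
  assumes X: "rot_closed X"
  obtains Y where "Y \<subseteq> X" "rot_closed Y" "card Y \<le> t" "t < card Y + d \<or> Y = X"
proof -
  let ?S = "{Y. Y \<subseteq> X \<and> rot_closed Y \<and> card Y \<le> t}"
  have fin: "finite X" using X by (simp add: rot_closed_def)
  have "finite ?S" using fin by simp
  moreover have "{} \<in> ?S" by (simp add: rot_closed_def)
  ultimately have "Max (card ` ?S) \<in> card ` ?S" by (intro Max_in) auto
  then obtain Y where Y: "Y \<in> ?S" and "card Y = Max (card ` ?S)" by auto
  then have max: "card Z \<le> card Y" if "Z \<in> ?S" for Z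
    using \<open>finite ?S\<close> that by simp
  have "t < card Y + d" if "Y \<noteq> X"
  proof (rule ccontr)
    assume t: "\<not> t < card Y + d"
    obtain x where x: "x \<in> X" "x \<notin> Y" using \<open>Y \<noteq> X\<close> Y by auto
    let ?O = "(\<lambda>n. (rotate_coords ^^ n) x) ` {..<d}"
    have "x \<in> prim_pos d" using X x by (auto simp: rot_closed_def)
    then have O: "rot_closed ?O" by (rule rot_closed_orbit)
    have OX: "(rotate_coords ^^ n) x \<in> X" for n
      by (induction n) (use x X in \<open>auto simp: rot_closed_def\<close>)
    have "x \<in> ?O" using d2 by (intro image_eqI[of _ _ 0]) auto
    have "card (Y \<union> ?O) \<le> card Y + d"
      using card_Un_le[of Y ?O] card_image_le[of "{..<d}" "\<lambda>n. (rotate_coords ^^ n) x"] by simp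
    then have "Y \<union> ?O \<in> ?S"
      using Y O OX t unfolding rot_closed_def by (auto simp: image_Un subset_iff)
    from max[OF this] have "card (Y \<union> ?O) \<le> card Y" .
    moreover have "Y \<subset> Y \<union> ?O" using x \<open>x \<in> ?O\<close> by blast
    moreover have "finite (Y \<union> ?O)" using Y O by (auto simp: rot_closed_def)
    ultimately show False using psubset_card_mono[of "Y \<union> ?O" Y] by simp
  qed
  then show ?thesis using that[of Y] Y by blast
qed

subsection \<open>Nearly balanced subsets of a layer\<close>

abbreviation swap_coords :: "nat \<Rightarrow> nat \<Rightarrow> int list \<Rightarrow> int list" where
  "swap_coords a b \<equiv> act (Transposition.transpose a b)"

lemma bij_swap: "a < d \<Longrightarrow> b < d \<Longrightarrow> bij_betw (Transposition.transpose a b) {..<d} {..<d}"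
  by (intro permutes_imp_bij permutes_swap_id) auto

lemma swap_coords_swap_coords:
  assumes "a < d" "b < d" "x \<in> prim_pos d" shows "swap_coords a b (swap_coords a b x) = x"
  using funpow_act_id[OF bij_swap[OF assms(1,2)] assms(3), of 2] by (simp add: numeral_2_eq_2)

text \<open>
  A subset minimising the sum of the squared column sums is nearly balanced: otherwise replacing one
  of its points by the same point with two coordinates exchanged would decrease that sum.
\<close>

lemma nearly_balanced_subset:
  assumes U: "finite U" "U \<subseteq> prim_pos d"
    and closed: "\<And>a b x. a < d \<Longrightarrow> b < d \<Longrightarrow> x \<in> U \<Longrightarrow> swap_coords a b x \<in> U"
    and h: "0 \<le> h" "\<And>a b x. a < d \<Longrightarrow> b < d \<Longrightarrow> x \<in> U \<Longrightarrow> \<bar>x ! a\<bar> - \<bar>x ! b\<bar> \<le> h"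
    and j: "j \<le> card U"
  obtains A where "A \<subseteq> U" "card A = j" "\<And>a b. a < d \<Longrightarrow> b < d \<Longrightarrow> col_sum a A - col_sum b A \<le> h"
proof -
  define Phi where "Phi A = (\<Sum>i<d. (col_sum i A)\<^sup>2)" for A
  let ?S = "{A. A \<subseteq> U \<and> card A = j}"
  obtain A0 where "A0 \<subseteq> U" "card A0 = j" using obtain_subset_with_card_n[OF j] by blast
  then have "A0 \<in> ?S" by simp
  then have "Min (Phi ` ?S) \<in> Phi ` ?S" using U(1) by (intro Min_in) auto
  then obtain A where A: "A \<subseteq> U" "card A = j" and "Phi A = Min (Phi ` ?S)" by auto
  then have min: "Phi A \<le> Phi B" if "B \<subseteq> U" "card B = j" for B
    using U(1) that by auto
  have fin: "finite A" using A U finite_subset by blast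
  have "col_sum a A - col_sum b A \<le> h" if ab: "a < d" "b < d" for a b
  proof (rule ccontr)
    assume D: "\<not> ?thesis"
    then have "a \<noteq> b" using h(1) by auto
    define S where "S = swap_coords a b"
    define g where "g x = \<bar>x ! a\<bar> - \<bar>x ! b\<bar>" for x :: "int list"
    have SS: "S (S x) = x" if "x \<in> U" for x
      using swap_coords_swap_coords[OF ab] that U by (auto simp: S_def)
    have gS: "g (S x) = - g x" for x
      using ab by (simp add: g_def S_def abs_act)
    \<comment> \<open>The exchange \<open>S\<close> permutes these points and negates
      \<open>g\<close>, so together they contribute nothing to the difference of the two columns.
      Hence some point of \<open>A\<close> with positive \<open>g\<close> has its exchanged point
      outside \<open>A\<close>.\<close>
    let ?A' = "{x \<in> A. S x \<in> A}"
    have "bij_betw S ?A' ?A'"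
      by (rule bij_betw_byWitness[of _ S]) (use SS A in auto)
    then have "(\<Sum>x\<in>?A'. g x) = (\<Sum>x\<in>?A'. g (S x))"
      using sum.reindex_bij_betw[of S ?A' ?A' g] by simp
    then have 0: "(\<Sum>x\<in>?A'. g x) = 0" by (simp add: gS sum_negf)
    have "(\<Sum>x\<in>A. g x) = col_sum a A - col_sum b A"
      by (simp add: g_def col_sum_def sum_subtractf)
    moreover have "(\<Sum>x\<in>A. g x) = (\<Sum>x\<in>A - ?A'. g x) + (\<Sum>x\<in>?A'. g x)"
      by (rule sum.subset_diff) (use fin in auto)
    ultimately have "0 < (\<Sum>x\<in>A - ?A'. g x)" using D h(1) 0 by simp
    then have "\<exists>x\<in>A - ?A'. 0 < g x"
      using sum_nonpos[of "A - ?A'" g] by (meson not_le)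
    then obtain x where x: "x \<in> A" "S x \<notin> A" "0 < g x" by blast
    have xU: "x \<in> U" using x A by blast
    then have SxU: "S x \<in> U" using closed ab by (simp add: S_def)
    have gx: "g x \<le> h" using h(2)[OF ab xU] by (simp add: g_def)
    let ?B = "insert (S x) (A - {x})"
    have col_sum_B: "col_sum i ?B = col_sum i A - \<bar>x ! i\<bar> + \<bar>S x ! i\<bar>" for i
      using x fin by (simp add: col_sum_def sum_diff1)
    let ?R = "\<lambda>X. \<Sum>i\<in>{..<d} - {a} - {b}. (col_sum i X)\<^sup>2"
    have a: "col_sum a ?B = col_sum a A - g x" and b: "col_sum b ?B = col_sum b A + g x"
      unfolding col_sum_B using ab by (auto simp: S_def abs_act g_def)
    have "col_sum i ?B = col_sum i A" if "i < d" "i \<noteq> a" "i \<noteq> b" for i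
      unfolding col_sum_B using that by (auto simp: S_def abs_act)
    then have R: "?R ?B = ?R A"
      by (intro sum.cong) auto
    have Phi: "Phi X = (col_sum a X)\<^sup>2 + ((col_sum b X)\<^sup>2 + ?R X)" for X
      unfolding Phi_def using ab \<open>a \<noteq> b\<close>
      by (simp add: sum.remove[of "{..<d}" a] sum.remove[of "{..<d} - {a}" b])
    \<comment> \<open>Replacing \<open>x\<close> by \<open>S x\<close> moves \<open>g x\<close> from
      column \<open>a\<close> to column \<open>b\<close>. Since \<open>g x\<close> is at most
      \<open>h\<close> and the difference of the columns exceeds \<open>h\<close>, the sum of
      squares drops.\<close>
    have "Phi ?B = Phi A - 2 * (g x * (col_sum a A - col_sum b A - g x))"
      unfolding Phi a b R by (simp add: power2_eq_square algebra_simps)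
    moreover have "0 < g x * (col_sum a A - col_sum b A - g x)"
      using x(3) gx D by (intro mult_pos_pos) auto
    ultimately have "Phi ?B < Phi A" by simp
    moreover have "card ?B = j"
      using x fin A card_Suc_Diff1[of A x] by simp
    then have "Phi A \<le> Phi ?B" using min[of ?B] A SxU by auto
    ultimately show False by simp
  qed
  then show ?thesis using that A by blast
qed

lemma sum_norm1_layer: "X \<subseteq> layer p \<Longrightarrow> (\<Sum>x\<in>X. norm1 x) = int p * int (card X)"
proof -
  assume "X \<subseteq> layer p"
  then have "(\<Sum>x\<in>X. norm1 x) = (\<Sum>x\<in>X. int p)" by (intro sum.cong) (auto simp: layer_def)
  then show ?thesis by simp
qed

lemma rot_closed_layer_col_sum:
  assumes "rot_closed Y" "Y \<subseteq> layer p" "i < d"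
  shows "int d * col_sum i Y = int p * int (card Y)"
  using rot_closed_col_sum[OF assms(1,3)] sum_norm1_layer[OF assms(2)] by simp

text \<open>Closed under all coordinate permutations, so \<open>nearly_balanced_subset\<close>
  applies to it and its complement in the layer is a union of rotation orbits.\<close>

definition flat_layer :: "nat \<Rightarrow> int \<Rightarrow> int list set" where
  "flat_layer p h = {x \<in> layer p. \<forall>a<d. \<forall>b<d. \<bar>x ! a\<bar> - \<bar>x ! b\<bar> \<le> h}"

lemma flat_layer_act:
  assumes "bij_betw \<pi> {..<d} {..<d}" "x \<in> flat_layer p h"
  shows "act \<pi> x \<in> flat_layer p h"
proof -
  have "\<pi> i < d" if "i < d" for i using assms(1) that by (auto simp: bij_betw_def)
  then show ?thesis using assms by (auto simp: flat_layer_def act_layer abs_act)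
qed

lemma finite_flat_layer: "finite (flat_layer p h)"
  by (rule finite_subset[OF _ finite_layer[of p]]) (auto simp: flat_layer_def)

lemma rot_closed_ball: "rot_closed (ball_prim d p)"
  using act_ball[OF bij_shift] finite_ball by (auto simp: rot_closed_def ball_prim_eq)

text \<open>If the rotation of \<open>x\<close> is flat, so is \<open>x\<close>, which is reached
  from it by \<open>d - 1\<close> further rotations.\<close>

lemma rot_closed_layer_diff_flat: "rot_closed (layer p - flat_layer p h)"
proof -
  have "x \<in> flat_layer p h" if x: "x \<in> layer p" and r: "rotate_coords x \<in> flat_layer p h" for x
  proof -
    have xp: "x \<in> prim_pos d" using x by (simp add: layer_def)
    have "(rotate_coords ^^ d) x \<in> flat_layer p h"
    proof -
      have "(rotate_coords ^^ n) (rotate_coords x) \<in> flat_layer p h" for n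
        by (induction n) (use r flat_layer_act[OF bij_shift] in auto)
      from this[of "d - 1"] show ?thesis
        using d2 funpow_swap1[of rotate_coords "d - 1" x] by (cases d) auto
    qed
    then show ?thesis
      using funpow_act_id[OF bij_shift xp, of d] by (simp add: funpow_shift)
  qed
  then show ?thesis
    using act_layer[OF bij_shift] finite_layer by (auto simp: rot_closed_def layer_def)
qed

text \<open>Orbits outside the flat layer supply most of the points at no imbalance. The remaining
  ones form a nearly balanced subset of the flat layer, where no column exceeds the average by more
  than \<open>(d - 1) * h / d\<close>.\<close>

lemma layer_subset_of_size:
  assumes "d - 1 \<le> card (flat_layer p h)" "0 \<le> h" "n \<le> card (layer p)"
  obtains B where "B \<subseteq> layer p" "card B = n"
    "\<And>i. i < d \<Longrightarrow> int d * col_sum i B \<le> int p * int n + int (d - 1) * h"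
proof -
  let ?U = "flat_layer p h"
  have UL: "?U \<subseteq> layer p" by (auto simp: flat_layer_def)
  obtain Y where Y: "Y \<subseteq> layer p - ?U" "rot_closed Y" "card Y \<le> n" "n < card Y + d \<or> Y = layer p - ?U"
    using rot_closed_subset_of_size[OF rot_closed_layer_diff_flat] by blast
  define j where "j = n - card Y"
  \<comment> \<open>Either fewer than \<open>d\<close> points are missing, or everything outside the
    flat layer is used and the rest fits inside it.\<close>
  have jU: "j \<le> card ?U"
    using Y(4)
  proof
    assume "n < card Y + d"
    then show ?thesis using assms(1) by (simp add: j_def)
  next
    assume "Y = layer p - ?U"
    then have "card Y = card (layer p) - card ?U"
      using UL finite_flat_layer by (simp add: card_Diff_subset)
    then show ?thesis using assms(3) by (simp add: j_def)
  qed
  have Upp: "?U \<subseteq> prim_pos d" by (auto simp: flat_layer_def layer_def)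
  have Uh: "\<bar>x ! a\<bar> - \<bar>x ! b\<bar> \<le> h" if "a < d" "b < d" "x \<in> ?U" for a b x
    using that by (auto simp: flat_layer_def)
  have Uc: "swap_coords a b x \<in> ?U" if "a < d" "b < d" "x \<in> ?U" for a b x
    using flat_layer_act[OF bij_swap] that by blast
  obtain A where A: "A \<subseteq> ?U" "card A = j" "\<And>a b. a < d \<Longrightarrow> b < d \<Longrightarrow> col_sum a A - col_sum b A \<le> h"
    by (rule nearly_balanced_subset[OF finite_flat_layer Upp Uc assms(2) Uh jU]) auto
  have fin: "finite A" "finite Y"
    using finite_subset[OF A(1) finite_flat_layer] Y(2) by (auto simp: rot_closed_def)
  have disj: "Y \<inter> A = {}" using Y A by blast
  show ?thesis
  proof (rule that[of "Y \<union> A"])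
    show "Y \<union> A \<subseteq> layer p" using Y A UL by blast
    show "card (Y \<union> A) = n"
      using Y(3) A(2) card_Un_disjoint[OF fin(2,1) disj] by (simp add: j_def)
    fix i assume i: "i < d"
    \<comment> \<open>Column \<open>i\<close> is compared with each of the other
      \<open>d - 1\<close> columns.\<close>
    have "(\<Sum>b\<in>{..<d} - {i}. col_sum i A) \<le> (\<Sum>b\<in>{..<d} - {i}. col_sum b A + h)"
      using A(3)[of i] i by (intro sum_mono) (auto simp: algebra_simps)
    then have "int d * col_sum i A \<le> (\<Sum>b<d. col_sum b A) + int (d - 1) * h"
      using i by (simp add: sum.distrib sum.remove[of "{..<d}" i] of_nat_diff algebra_simps)
    also have "(\<Sum>b<d. col_sum b A) = int p * int j"
      using A UL sum_norm1_layer[of A p] by (simp add: sum_col_sum)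
    finally have "int d * col_sum i A \<le> int p * int j + int (d - 1) * h" .
    moreover have "int d * col_sum i Y = int p * int (card Y)"
      using rot_closed_layer_col_sum[OF Y(2) _ i] Y(1) by blast
    ultimately show "int d * col_sum i (Y \<union> A) \<le> int p * int n + int (d - 1) * h"
      using Y(3) by (simp add: col_sum_union[OF fin(2,1) disj] j_def of_nat_diff algebra_simps)
  qed
qed

text \<open>The ball is rotation-closed, so every column attains the maximum in
  \<open>kappa\<close>.\<close>

lemma kappa_p_col_sum: "i < d \<Longrightarrow> col_sum i (ball_prim d p) = kappa_p d p"
proof -
  assume i: "i < d"
  have eq: "col_sum j (ball_prim d p) = col_sum i (ball_prim d p)" if "j < d" for j
  proof -
    have "int d * col_sum j (ball_prim d p) = int d * col_sum i (ball_prim d p)"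
      by (simp only: rot_closed_col_sum[OF rot_closed_ball] that i)
    then show ?thesis using d2 by simp
  qed
  have "(\<lambda>j. col_sum j (ball_prim d p)) ` {..<d} = (\<lambda>_. col_sum i (ball_prim d p)) ` {..<d}"
    by (intro image_cong refl eq) simp
  also have "\<dots> = {col_sum i (ball_prim d p)}"
    using i by auto
  finally show ?thesis by (simp add: kappa_p_def kappa_def flip: col_sum_def)
qed

lemma sum_norm1_ball: "(\<Sum>x\<in>ball_prim d p. norm1 x) = int d * kappa_p d p"
  using rot_closed_col_sum[OF rot_closed_ball, of 0 p] kappa_p_col_sum[of 0 p] d2 by simp

lemma rot_closed_layer: "rot_closed (layer p)"
  using act_layer[OF bij_shift] finite_layer by (auto simp: rot_closed_def layer_def)

lemma kappa_p_split:
  assumes "1 \<le> p"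
  shows "int d * kappa_p d p = int d * kappa_p d (p - 1) + int p * int (card (layer p))"
proof -
  have 0: "0 < d" using d2 by simp
  have "kappa_p d p = kappa_p d (p - 1) + col_sum 0 (layer p)"
    using col_sum_union[OF finite_ball finite_layer ball_layer_disjoint[OF assms], of 0]
    by (simp only: ball_split[OF assms, symmetric] kappa_p_col_sum[OF 0])
  then show ?thesis
    using rot_closed_layer_col_sum[OF rot_closed_layer _ 0, of p] by (simp add: algebra_simps)
qed

subsection \<open>Bounds for packings\<close>

text \<open>With the weight \<open>norm1 x - p\<close>, points of layer \<open>p\<close> cost
  nothing, while adding a point beyond it or omitting a point of the ball costs a non-negative
  amount.\<close>

lemma sum_norm1_diff_ball:
  assumes "finite X" "X \<subseteq> prim_pos d" "1 \<le> p"
  shows "(\<Sum>x\<in>X. norm1 x - int p) = (\<Sum>x\<in>ball_prim d (p - 1). norm1 x - int p)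
    + (\<Sum>x\<in>X - ball_prim d (p - 1). norm1 x - int p) + (\<Sum>x\<in>ball_prim d (p - 1) - X. int p - norm1 x)"
proof -
  let ?B = "ball_prim d (p - 1)" and ?f = "\<lambda>x. norm1 x - int p"
  have "sum ?f X = sum ?f (X - ?B) + sum ?f (X \<inter> ?B)"
    using assms(1) sum.Int_Diff[of X ?f ?B] by simp
  moreover have "sum ?f ?B = sum ?f (?B - X) + sum ?f (X \<inter> ?B)"
    using finite_ball[of "p - 1"] sum.Int_Diff[of ?B ?f X] by (simp add: Int_commute)
  moreover have "(\<Sum>x\<in>?B - X. int p - norm1 x) = - sum ?f (?B - X)"
    by (simp flip: sum_negf)
  ultimately show ?thesis by simp
qed

lemma norm1_outside_ball: "x \<in> prim_pos d \<Longrightarrow> 1 \<le> p \<Longrightarrow> x \<notin> ball_prim d (p - 1) \<Longrightarrow> int p \<le> norm1 x"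
  by (auto simp: ball_prim_eq)

lemma norm1_inside_ball: "1 \<le> p \<Longrightarrow> x \<in> ball_prim d (p - 1) \<Longrightarrow> norm1 x < int p"
  by (auto simp: ball_prim_eq)

text \<open>The total norm of a packing is at most \<open>d * k\<close>. Both penalty sums are
  retained because the equality case is analysed in \<open>exception_dvd\<close>.\<close>

lemma packing_excess:
  assumes X: "finite X" "X \<subseteq> prim_pos d" "kappa d X \<le> int k" and p: "1 \<le> p"
  shows "int p * (int (card X) - int (N_p d (p - 1)))
    + (\<Sum>x\<in>X - ball_prim d (p - 1). norm1 x - int p) + (\<Sum>x\<in>ball_prim d (p - 1) - X. int p - norm1 x)
    \<le> int d * (int k - kappa_p d (p - 1))"
proof -
  have "(\<Sum>i<d. col_sum i X) \<le> (\<Sum>i<d. int k)"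
    using X(3) by (intro sum_mono) (simp add: kappa_le_iff)
  then have "(\<Sum>x\<in>X. norm1 x) \<le> int d * int k" by (simp add: sum_col_sum)
  then show ?thesis
    using sum_norm1_diff_ball[OF X(1,2) p]
    by (simp add: sum_subtractf[of norm1] sum_norm1_ball N_p_def algebra_simps)
qed

lemma packing_upper:
  assumes X: "finite X" "X \<subseteq> prim_pos d" "kappa d X \<le> int k" and p: "1 \<le> p"
  shows "int p * (int (card X) - int (N_p d (p - 1))) \<le> int d * (int k - kappa_p d (p - 1))"
proof -
  have "0 \<le> (\<Sum>x\<in>X - ball_prim d (p - 1). norm1 x - int p)"
    using X norm1_outside_ball[OF _ p] by (intro sum_nonneg) auto
  moreover have "0 \<le> (\<Sum>x\<in>ball_prim d (p - 1) - X. int p - norm1 x)"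
    using norm1_inside_ball[OF p] by (intro sum_nonneg) force
  ultimately show ?thesis using packing_excess[OF assms] by linarith
qed

text \<open>\<open>packing_upper\<close> with \<open>p = 1\<close> bounds every size; finiteness
  gives the \<open>Max\<close> in \<open>delta_z\<close> its meaning.\<close>

lemma finite_packing_sizes:
  "finite {card X | X. finite X \<and> X \<subseteq> prim_pos d \<and> kappa d X \<le> int k}" (is "finite ?S")
proof (rule finite_subset)
  show "?S \<subseteq> {.. nat (int (N_p d 0) + int d * (int k - kappa_p d 0))}"
    using packing_upper[of _ k 1] by fastforce
qed simp

lemma card_le_delta:
  assumes "finite X" "X \<subseteq> prim_pos d" "\<And>i. i < d \<Longrightarrow> col_sum i X \<le> int k"
  shows "card X \<le> delta_z d k"
  unfolding delta_z_def
  by (rule Max_ge[OF finite_packing_sizes]) (use assms kappa_le_iff in blast)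

lemma delta_attained:
  obtains X where "finite X" "X \<subseteq> prim_pos d" "kappa d X \<le> int k" "card X = delta_z d k"
proof -
  have "kappa d {} \<le> int k" by (simp add: kappa_le_iff col_sum_def)
  then have "delta_z d k \<in> {card X | X. finite X \<and> X \<subseteq> prim_pos d \<and> kappa d X \<le> int k}"
    unfolding delta_z_def by (intro Max_in[OF finite_packing_sizes]) blast
  then show ?thesis using that by auto
qed

lemma delta_upper:
  "1 \<le> p \<Longrightarrow> int p * (int (delta_z d k) - int (N_p d (p - 1))) \<le> int d * (int k - kappa_p d (p - 1))"
  by (metis delta_attained packing_upper)

lemma delta_mono: "k \<le> l \<Longrightarrow> delta_z d k \<le> delta_z d l"
proof -
  assume kl: "k \<le> l"
  obtain X where X: "finite X" "X \<subseteq> prim_pos d" "kappa d X \<le> int k" "card X = delta_z d k"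
    by (rule delta_attained)
  have "card X \<le> delta_z d l"
  proof (rule card_le_delta)
    show "col_sum i X \<le> int l" if "i < d" for i
      using X(3) that kl unfolding kappa_le_iff by fastforce
  qed (use X in auto)
  then show ?thesis using X(4) by simp
qed

text \<open>The ball of radius \<open>p - 1\<close> uses exactly \<open>kappa_p d (p - 1)\<close> in
  every column, leaving the rest of the budget to \<open>B\<close>.\<close>

lemma delta_lower:
  assumes p: "1 \<le> p" and B: "B \<subseteq> layer p" "\<And>i. i < d \<Longrightarrow> col_sum i B \<le> int k - kappa_p d (p - 1)"
  shows "N_p d (p - 1) + card B \<le> delta_z d k"
proof -
  let ?b = "ball_prim d (p - 1)"
  have fin: "finite B" using B(1) finite_layer finite_subset by blast
  have disj: "?b \<inter> B = {}" using ball_layer_disjoint[OF p] B(1) by blast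
  have "card (?b \<union> B) \<le> delta_z d k"
  proof (rule card_le_delta)
    show "finite (?b \<union> B)" using finite_ball fin by simp
    show "?b \<union> B \<subseteq> prim_pos d" using B(1) by (auto simp: ball_prim_eq layer_def)
    show "col_sum i (?b \<union> B) \<le> int k" if "i < d" for i
      using B(2)[OF that] unfolding col_sum_union[OF finite_ball fin disj] kappa_p_col_sum[OF that] by simp
  qed
  then show ?thesis unfolding card_Un_disjoint[OF finite_ball fin disj] N_p_def .
qed

section \<open>Growth of \<open>kappa_p\<close> and the interpolation level of
  \<open>k\<close>\<close>

lemma kappa_p_mono: "p \<le> q \<Longrightarrow> kappa_p d p \<le> kappa_p d q"
proof -
  assume "p \<le> q"
  then have "ball_prim d p \<subseteq> ball_prim d q" by (auto simp: ball_prim_eq)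
  then have "col_sum 0 (ball_prim d p) \<le> col_sum 0 (ball_prim d q)" by (rule col_sum_mono[OF finite_ball])
  then show ?thesis using d2 by (simp add: kappa_p_col_sum)
qed

lemma N_p_mono: "p \<le> q \<Longrightarrow> N_p d p \<le> N_p d q"
  unfolding N_p_def by (rule card_mono[OF finite_ball]) (auto simp: ball_prim_eq)

lemma kappa_p_0: "kappa_p d 0 = 0"
proof -
  have "ball_prim d 0 = {}"
  proof -
    have "0 < norm1 x" if x: "x \<in> prim_pos d" for x
    proof -
      obtain i where "i < d" "x ! i \<noteq> 0" 
        using Gcd_nonzero[OF prim_posD(1)[OF x] prim_posD(2)[OF x]] by blast
      then show ?thesis using abs_nth_le_norm1[of i x] by simp
    qed
    then show ?thesis by (force simp: ball_prim_eq)
  qed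
  then show ?thesis using kappa_p_col_sum[of 0 0] d2 by (simp add: col_sum_def)
qed

text \<open>Uses the points \<open>(1, y)\<close> with all entries of \<open>y\<close> between \<open>M\<close> and \<open>2 M\<close>.\<close>

lemma kappa_p_ge_power: "int M ^ d \<le> kappa_p d (2 * d * M)"
proof (cases "M = 0")
  case True
  then show ?thesis using kappa_p_0 d2 by (simp add: power_0_left)
next
  case False
  let ?L = "{y. set y \<subseteq> {int M..2 * int M} \<and> length y = d - 1}"
  have fin: "finite ?L" by (rule finite_lists_length_eq) simp
  let ?Z = "(#) 1 ` ?L"
  have mem: "y ! i \<in> {int M..2 * int M}" if "y \<in> ?L" "i < d - 1" for y i
  proof -
    have "y ! i \<in> set y" "set y \<subseteq> {int M..2 * int M}" using that by auto
    then show ?thesis by blast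
  qed
  have "?Z \<subseteq> ball_prim d (2 * d * M)"
  proof safe
    fix y assume y: "set y \<subseteq> {int M..2 * int M}" "length y = d - 1"
    have l: "length (1 # y) = d" using y d2 by simp
    have "1 # y \<in> prim_pos d"
      by (rule prim_posI_pos[OF l]) (auto intro: Gcd_coprime[of 1 _ 1])
    moreover have "norm1 (1 # y) \<le> (\<Sum>i<d. 2 * int M)"
      unfolding norm1_def
    proof (rule sum_mono)
      fix i assume "i \<in> {..<d}"
      then show "\<bar>(1 # y) ! i\<bar> \<le> 2 * int M"
        using mem[of y "i - 1"] y False by (cases i) (auto simp: less_diff_conv)
    qed
    ultimately show "1 # y \<in> ball_prim d (2 * d * M)"
      by (simp add: ball_prim_eq algebra_simps)
  qed
  \<comment> \<open>Column 1 holds the first entry of \<open>y\<close>, which is at least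
    \<open>M\<close> in each of the \<open>(M + 1) ^ (d - 1)\<close> points.\<close>
  then have "col_sum 1 ?Z \<le> col_sum 1 (ball_prim d (2 * d * M))"
    by (rule col_sum_mono[OF finite_ball])
  also have "\<dots> = kappa_p d (2 * d * M)"
    using d2 by (intro kappa_p_col_sum) simp
  finally have le: "col_sum 1 ?Z \<le> kappa_p d (2 * d * M)" .
  have ge: "int (card ?Z) * int M \<le> col_sum 1 ?Z"
    unfolding col_sum_def
  proof (rule sum_bounded_below)
    fix x assume "x \<in> ?Z"
    then obtain y where "x = 1 # y" "y \<in> ?L" by blast
    then show "int M \<le> \<bar>x ! 1\<bar>" using mem[of y 0] d2 by simp
  qed
  have card_Z: "card ?Z = (M + 1) ^ (d - 1)"
    by (subst card_image) (simp_all add: card_lists_length_eq nat_add_distrib)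
  have "int M ^ d \<le> int ((M + 1) ^ (d - 1)) * int M"
  proof -
    have "int M ^ d = int M ^ (d - 1) * int M" using d2 by (cases d) auto
    also have "\<dots> \<le> int ((M + 1) ^ (d - 1)) * int M"
      by (intro mult_right_mono) (auto intro: power_mono)
    finally show ?thesis .
  qed
  then show ?thesis using le ge unfolding card_Z by linarith
qed

text \<open>The index \<open>p\<close> in \<open>lambda_dk\<close>, as a function of
  \<open>k\<close>.\<close>

definition level :: "nat \<Rightarrow> nat" where
  "level k = (LEAST p. p > 0 \<and> int k < kappa_p d p)"

lemma level_exists: "\<exists>p>0. int k < kappa_p d p"
proof (intro exI conjI)
  have "int k + 1 \<le> int (k + 1) ^ d"
    using d2 self_le_power[of "int (k + 1)" d] by simp
  then show "int k < kappa_p d (2 * d * (k + 1))"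
    using kappa_p_ge_power[of "k + 1"] by linarith
qed (use d2 in simp)

lemma level_bounds: "1 \<le> level k" "int k < kappa_p d (level k)" "kappa_p d (level k - 1) \<le> int k"
proof -
  show 1: "1 \<le> level k" and "int k < kappa_p d (level k)"
    using LeastI_ex[OF level_exists[of k]] by (auto simp: level_def)
  show "kappa_p d (level k - 1) \<le> int k"
  proof (cases "level k = 1")
    case True
    then show ?thesis using kappa_p_0 by simp
  next
    case False
    then show ?thesis
      using 1 not_less_Least[of "level k - 1" "\<lambda>p. p > 0 \<and> int k < kappa_p d p"]
      by (auto simp: level_def)
  qed
qed

lemma level_le: "0 < p \<Longrightarrow> int k < kappa_p d p \<Longrightarrow> level k \<le> p"
  unfolding level_def by (rule Least_le) simp

lemma level_eqI:
  assumes "1 \<le> p" "kappa_p d (p - 1) \<le> int k" "int k < kappa_p d p"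
  shows "level k = p"
proof (rule antisym)
  show "level k \<le> p" using level_le assms by simp
  show "p \<le> level k"
  proof (rule ccontr)
    assume "\<not> ?thesis"
    then have "kappa_p d (level k) \<le> kappa_p d (p - 1)" by (intro kappa_p_mono) simp
    then show False using level_bounds(2)[of k] assms(2) by simp
  qed
qed

lemma level_mono: "k \<le> l \<Longrightarrow> level k \<le> level l"
  using level_le[of "level l" k] level_bounds[of l] by simp

text \<open>This is \<open>m\<close> of the introduction, and \<open>extra\<close> below is
  \<open>n\<close>. The conversion \<open>nat\<close> truncates nothing, by
  \<open>level_bounds\<close>.\<close>

definition excess :: "nat \<Rightarrow> nat" where
  "excess k = nat (int k - kappa_p d (level k - 1))"

lemma excess_eq: "int k = kappa_p d (level k - 1) + int (excess k)"
  using level_bounds(3)[of k] by (simp add: excess_def)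

definition extra :: "nat \<Rightarrow> nat" where
  "extra k = (d * excess k) div level k"

lemma floor_lambda: "\<lfloor>lambda_dk d k\<rfloor> = int (N_p d (level k - 1)) + int (extra k)"
proof -
  have "lambda_dk d k = of_int (int (N_p d (level k - 1)))
      + real_of_int (int (d * excess k)) / real_of_int (int (level k))"
    using excess_eq[of k] unfolding lambda_dk_def Let_def level_def[symmetric] by simp
  then have "\<lfloor>lambda_dk d k\<rfloor> = int (N_p d (level k - 1)) + int (d * excess k) div int (level k)"
    by (simp only: floor_divide_of_int_eq int_add_floor[symmetric])
  then show ?thesis by (simp only: extra_def zdiv_int)
qed

text \<open>Since \<open>k\<close> lies below \<open>kappa_p\<close> at its level,
  \<open>d * excess k\<close> is less than the level times the layer size. So the layer holds enough
  points to choose \<open>extra k\<close> of them.\<close>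

lemma extra_less: "extra k < card (layer (level k))"
proof -
  have "int d * int (excess k) < int (level k) * int (card (layer (level k)))"
    using kappa_p_split[OF level_bounds(1)[of k]] level_bounds(2)[of k] excess_eq[of k] d2
    by (smt (verit, best) distrib_left mult_less_cancel_left_pos of_nat_0_less_iff zero_less_numeral order_less_le_trans)
  then have "d * excess k < card (layer (level k)) * level k"
    by (metis mult.commute of_nat_less_iff of_nat_mult)
  then show ?thesis
    using level_bounds(1)[of k] by (simp add: extra_def div_less_iff_less_mult)
qed

lemma delta_le_floor: "int (delta_z d k) \<le> \<lfloor>lambda_dk d k\<rfloor>"
proof -
  have "int (level k) * (int (delta_z d k) - int (N_p d (level k - 1))) \<le> int (d * excess k)"
    using delta_upper[OF level_bounds(1)[of k], of k] excess_eq[of k] by simp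
  then have "int (level k) * (int (delta_z d k) - int (N_p d (level k - 1))) div int (level k)
      \<le> int (d * excess k) div int (level k)"
    using level_bounds(1)[of k] by (intro zdiv_mono1) auto
  then have "int (delta_z d k) - int (N_p d (level k - 1)) \<le> int (d * excess k) div int (level k)"
    using level_bounds(1)[of k] by simp
  then show ?thesis unfolding floor_lambda extra_def zdiv_int by linarith
qed

subsection \<open>Points with nearly equal coordinates\<close>

abbreviation vec :: "(nat \<Rightarrow> int) \<Rightarrow> int list" where
  "vec f \<equiv> map f [0..<d]"

lemma vec_in_layer:
  assumes "\<And>i. i < d \<Longrightarrow> 0 \<le> f i" "a < d" "b < d" "coprime (f a) (f b)" "(\<Sum>i<d. f i) = int p"
  shows "vec f \<in> layer p"
proof -
  have "Gcd (set (vec f)) = 1"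
    by (rule Gcd_coprime[of "f a" _ "f b"]) (use assms in auto)
  moreover have "norm1 (vec f) = (\<Sum>i<d. f i)"
    unfolding norm1_def using assms(1) by (intro sum.cong) auto
  ultimately show ?thesis
    using assms by (auto simp: layer_def intro!: prim_posI_nonneg)
qed

text \<open>Write \<open>p = q * d + r\<close> with \<open>0 < r < d\<close> and add 1 to
  \<open>r\<close> of the coordinates of (q,...,q). Both \<open>q\<close> and \<open>q + 1\<close>
  occur, so the point is primitive, and there are \<open>d choose r\<close> such points.\<close>

lemma card_flat_layer_1:
  assumes "\<not> d dvd p" shows "d \<le> card (flat_layer p 1)"
proof -
  define q where "q = int (p div d)"
  define r where "r = p mod d"
  have r: "0 < r" "r < d" using assms d2 by (auto simp: r_def mod_greater_zero_iff_not_dvd)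
  let ?v = "\<lambda>B. vec (\<lambda>i. q + of_bool (i \<in> B))"
  let ?S = "{B. B \<subseteq> {..<d} \<and> card B = r}"
  have "?v B \<in> flat_layer p 1" if "B \<in> ?S" for B
  proof -
    have B: "B \<subseteq> {..<d}" "card B = r" using that by auto
    have "B \<noteq> {}" "B \<noteq> {..<d}" using B r by auto
    then obtain a b where ab: "a \<in> B" "b < d" "b \<notin> B" using B by auto
    have "{i. i < d \<and> i \<in> B} = B" using B by auto
    then have "(\<Sum>i<d. q + of_bool (i \<in> B)) = int p"
      using B(2) by (simp add: sum.distrib sum_of_bool_eq q_def r_def Int_absorb1 B(1) flip: of_nat_mult of_nat_add)
    moreover have "coprime (q + 1) q" by simp
    ultimately have "?v B \<in> layer p"
      using ab B(1) by (intro vec_in_layer[of _ a b]) (auto simp: q_def)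
    then show ?thesis by (auto simp: flat_layer_def q_def)
  qed
  then have "?v ` ?S \<subseteq> flat_layer p 1" by blast
  moreover have "inj_on ?v ?S"
  proof (rule inj_onI)
    fix A B assume A: "A \<in> ?S" and B: "B \<in> ?S" and eq: "?v A = ?v B"
    have "i \<in> A \<longleftrightarrow> i \<in> B" if "i < d" for i
      using arg_cong[OF eq, of "\<lambda>x. x ! i"] that by (auto split: if_splits)
    then show "A = B" using A B by auto
  qed
  ultimately have "card ?S \<le> card (flat_layer p 1)"
    using card_inj_on_le finite_flat_layer by blast
  then show ?thesis
    using le_binomial[OF r] n_subsets[of "{..<d}" r] by simp
qed

text \<open>The vector (q,...,q) shifted by e_a - e_b, a root of type A.\<close>

definition root_vec :: "nat \<Rightarrow> nat \<Rightarrow> nat \<Rightarrow> int list" where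
  "root_vec q a b = vec (\<lambda>i. int q + of_bool (i = a) - of_bool (i = b))"

lemma length_root_vec [simp]: "length (root_vec q a b) = d"
  by (simp add: root_vec_def)

lemma nth_root_vec [simp]: "i < d \<Longrightarrow> root_vec q a b ! i = int q + of_bool (i = a) - of_bool (i = b)"
  by (simp add: root_vec_def)

lemma root_vec_layer:
  assumes "1 \<le> q" "3 \<le> d" "a < d" "b < d" "a \<noteq> b"
  shows "root_vec q a b \<in> layer (q * d)"
proof -
  \<comment> \<open>A third coordinate still equals \<open>q\<close> and is coprime to the entry
    \<open>q + 1\<close> at position \<open>a\<close>.\<close>
  have "\<exists>c<3::nat. c \<noteq> a \<and> c \<noteq> b" by presburger
  then obtain c where c: "c < d" "c \<noteq> a" "c \<noteq> b" using assms(2) by (meson order_less_le_trans)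
  have "(\<Sum>i<d. int q + of_bool (i = a) - of_bool (i = b)) = int (q * d)"
    using assms(3,4) by (simp add: sum.distrib sum_subtractf sum_of_bool_eq)
  then show ?thesis
    unfolding root_vec_def using assms c
    by (intro vec_in_layer[of _ a c]) auto
qed

lemma root_vec_flat:
  assumes "1 \<le> q" "3 \<le> d" "a < d" "b < d" "a \<noteq> b"
  shows "root_vec q a b \<in> flat_layer (q * d) 2"
  using root_vec_layer[OF assms] assms(1) by (auto simp: flat_layer_def of_bool_def)

lemma root_vec_eq_iff:
  assumes "a < d" "b < d" "a' < d" "b' < d" "a \<noteq> b" "a' \<noteq> b'"
  shows "root_vec q a b = root_vec q a' b' \<longleftrightarrow> a = a' \<and> b = b'"
proof
  assume eq: "root_vec q a b = root_vec q a' b'"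
  have "root_vec q a b ! a = root_vec q a' b' ! a" "root_vec q a b ! b = root_vec q a' b' ! b"
    by (simp_all add: eq)
  then show "a = a' \<and> b = b'" using assms by (auto simp: of_bool_def split: if_splits)
qed simp

lemma card_flat_layer_2:
  assumes "1 \<le> q" "3 \<le> d" shows "d - 1 \<le> card (flat_layer (q * d) 2)"
proof -
  have "inj_on (root_vec q 0) {1..<d}"
    by (rule inj_onI) (use d2 in \<open>simp add: root_vec_eq_iff\<close>)
  moreover have "root_vec q 0 ` {1..<d} \<subseteq> flat_layer (q * d) 2"
    using root_vec_flat[OF assms] d2 by auto
  ultimately have "card {1..<d} \<le> card (flat_layer (q * d) 2)"
    using card_inj_on_le finite_flat_layer by blast
  then show ?thesis by simp
qed

text \<open>In the plane a single flat point is required, and (q + c, q - c) is one.\<close>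

lemma flat_layer_plane:
  assumes "d = 2" "c \<le> q" "coprime (int q + int c) (int q - int c)"
  shows "d - 1 \<le> card (flat_layer (q * d) (2 * int c))"
proof -
  let ?f = "\<lambda>i::nat. if i = 0 then int q + int c else int q - int c"
  have s: "(\<Sum>i<d. ?f i) = int (q * d)"
    by (simp add: assms(1) numeral_2_eq_2)
  have "vec ?f \<in> layer (q * d)"
    using assms by (intro vec_in_layer[of _ 0 1] s) auto
  then have "vec ?f \<in> flat_layer (q * d) (2 * int c)"
    using assms(2) by (auto simp: flat_layer_def)
  then have "0 < card (flat_layer (q * d) (2 * int c))"
    using finite_flat_layer card_gt_0_iff by blast
  then show ?thesis using assms(1) by simp
qed

text \<open>A common divisor of \<open>q + c\<close> and \<open>q - c\<close> divides
  \<open>2 * c\<close>, and it is odd when \<open>c\<close> and \<open>q\<close> have opposite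
  parity. Hence \<open>c\<close> is 1 for even \<open>q\<close> and 2 for odd \<open>q\<close> from
  3 on; for \<open>q = 1\<close> the point (1, 1) serves, with \<open>c = 0\<close>.\<close>

lemma flat_plane_width:
  assumes "d = 2" "1 \<le> q"
  obtains c :: nat where "c \<le> q" "c \<le> 2" "d - 1 \<le> card (flat_layer (q * d) (2 * int c))"
proof -
  consider "q = 1" | "even q" | "odd q" "3 \<le> q"
    using assms(2) by (metis Suc_1 Suc_leI eval_nat_numeral(3) le_neq_implies_less odd_even_add one_add_one even_numeral)
  then have "\<exists>c\<le>2. c \<le> q \<and> coprime (int q + int c) (int q - int c)"
  proof cases
    case 1
    then show ?thesis by (intro exI[of _ 0]) simp
  next
    case 2
    have "coprime (int q + 1) (int q - 1)"
    proof (rule coprimeI)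
      fix g assume g: "g dvd int q + 1" "g dvd int q - 1"
      then have "g dvd (int q + 1) - (int q - 1)" by (rule dvd_diff)
      then have "g dvd 2" by simp
      moreover have "odd g" using g(1) 2 by (meson dvd_trans even_of_nat odd_add odd_one)
      ultimately show "is_unit g"
        by (metis coprime_right_2_iff_odd coprime_absorb_left)
    qed
    then show ?thesis using assms(2) by (intro exI[of _ 1]) simp
  next
    case 3
    have "coprime (int q + 2) (int q - 2)"
    proof (rule coprimeI)
      fix g assume g: "g dvd int q + 2" "g dvd int q - 2"
      then have "g dvd (int q + 2) - (int q - 2)" by (rule dvd_diff)
      then have "g dvd 2 ^ 2" by simp
      moreover have "odd g" using g(1) 3 by (meson dvd_trans even_of_nat even_add even_numeral)
      ultimately show "is_unit g"
        by (metis coprime_right_2_iff_odd coprime_absorb_left coprime_power_right_iff)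
    qed
    then show ?thesis using 3 by (intro exI[of _ 2]) simp
  qed
  then show ?thesis using that flat_layer_plane[OF assms(1)] by blast
qed

text \<open>The slack \<open>c\<close> is the imbalance \<open>(d - 1) * h / d\<close> rounded down.
  Width 2 gives slack 1 if \<open>d\<close> is at least 3; in the plane width \<open>2 * c\<close>
  gives \<open>c\<close>. The bound \<open>c \<le> q\<close> lets one omitted point pay for the
  slack.\<close>

lemma layer_subset_divisible:
  assumes "1 \<le> q"
  obtains c :: nat where "c \<le> q" "c \<le> 2" "3 \<le> d \<Longrightarrow> c \<le> 1"
    "\<And>n. n \<le> card (layer (q * d)) \<Longrightarrow>
      \<exists>B\<subseteq>layer (q * d). card B = n \<and> (\<forall>i<d. col_sum i B \<le> int (q * n + c))"
proof -
  have "\<exists>c h. c \<le> q \<and> c \<le> 2 \<and> (3 \<le> d \<longrightarrow> c \<le> 1) \<and> 0 \<le> h \<and> int (d - 1) * h < int d * (int c + 1) \<and>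
      d - 1 \<le> card (flat_layer (q * d) h)"
  proof (cases "d = 2")
    case True
    obtain c where "c \<le> q" "c \<le> 2" "d - 1 \<le> card (flat_layer (q * d) (2 * int c))"
      using flat_plane_width[OF True assms] .
    then show ?thesis using True by (intro exI[of _ c] exI[of _ "2 * int c"]) simp
  next
    case False
    then have "3 \<le> d" using d2 by simp
    then show ?thesis
      using assms card_flat_layer_2[OF assms]
      by (intro exI[of _ 1] exI[of _ 2]) (simp add: of_nat_diff)
  qed
  then obtain c h where c: "c \<le> q" "c \<le> 2" "3 \<le> d \<Longrightarrow> c \<le> 1"
    and h: "0 \<le> h" "int (d - 1) * h < int d * (int c + 1)" "d - 1 \<le> card (flat_layer (q * d) h)"
    by blast
  show ?thesis
  proof (rule that[OF c])
    fix n assume n: "n \<le> card (layer (q * d))"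
    obtain B where B: "B \<subseteq> layer (q * d)" "card B = n"
      "\<And>i. i < d \<Longrightarrow> int d * col_sum i B \<le> int (q * d) * int n + int (d - 1) * h"
      by (rule layer_subset_of_size[OF h(3,1) n]) blast
    have "col_sum i B \<le> int (q * n + c)" if "i < d" for i
    proof -
      have "int d * col_sum i B < int d * (int (q * n + c) + 1)"
        using B(3)[OF that] h(2) by (simp add: algebra_simps)
      then have "col_sum i B < int (q * n + c) + 1"
        using d2 by (simp only: mult_less_cancel_left_pos of_nat_0_less_iff)
      then show ?thesis by simp
    qed
    then show "\<exists>B\<subseteq>layer (q * d). card B = n \<and> (\<forall>i<d. col_sum i B \<le> int (q * n + c))"
      using B(1,2) by blast
  qed
qed

section \<open>Values of \<open>delta_z\<close> at levels prime or divisible by \<open>d\<close>: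
  the general lower bounds\<close>

lemma delta_ge_subset:
  assumes "B \<subseteq> layer (level k)" "\<And>i. i < d \<Longrightarrow> col_sum i B \<le> int (excess k)"
  shows "int (N_p d (level k - 1)) + int (card B) \<le> int (delta_z d k)"
proof -
  have "N_p d (level k - 1) + card B \<le> delta_z d k"
    by (rule delta_lower[OF level_bounds(1) assms(1)]) (use assms(2) excess_eq[of k] in force)
  then show ?thesis by linarith
qed

text \<open>Width 1 leaves an imbalance of at most \<open>(d - 1) / d\<close>, which is below 1 and
  vanishes because column sums are integers.\<close>

lemma delta_level_not_dvd:
  assumes "\<not> d dvd level k" shows "int (delta_z d k) = \<lfloor>lambda_dk d k\<rfloor>"
proof -
  have "d - 1 \<le> card (flat_layer (level k) 1)" using card_flat_layer_1[OF assms] by simp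
  then obtain B where B: "B \<subseteq> layer (level k)" "card B = extra k"
    "\<And>i. i < d \<Longrightarrow> int d * col_sum i B \<le> int (level k) * int (extra k) + int (d - 1) * 1"
    using layer_subset_of_size[OF _ _ less_imp_le[OF extra_less], of k 1] by auto
  have "level k * extra k \<le> d * excess k" by (simp add: extra_def)
  then have le: "int (level k) * int (extra k) \<le> int d * int (excess k)"
    by (simp flip: of_nat_mult)
  have "col_sum i B \<le> int (excess k)" if "i < d" for i
  proof -
    have "int d * col_sum i B < int d * (int (excess k) + 1)"
      using B(3)[OF that] le d2 by (simp add: of_nat_diff algebra_simps)
    then have "col_sum i B < int (excess k) + 1"
      using d2 by (simp only: mult_less_cancel_left_pos of_nat_0_less_iff)
    then show ?thesis by simp
  qed
  from delta_ge_subset[OF B(1) this] show ?thesis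
    using delta_le_floor[of k] B(2) by (simp add: floor_lambda)
qed

lemma extra_level_dvd:
  assumes "level k = q * d" shows "extra k = excess k div q"
  using d2 by (simp add: extra_def assms mult.commute[of q])

text \<open>Here \<open>excess k = q * extra k + excess k mod q\<close>. All \<open>extra k\<close>
  points fit if the remainder is at least the slack \<open>c\<close>; with one point fewer, a
  further \<open>q\<close> is free in each column and covers \<open>c\<close>.\<close>

lemma delta_level_dvd:
  assumes q: "level k = q * d"
  shows "\<lfloor>lambda_dk d k\<rfloor> - 1 \<le> int (delta_z d k)"
    and "int (delta_z d k) \<noteq> \<lfloor>lambda_dk d k\<rfloor> \<Longrightarrow> excess k mod q < 2"
    and "int (delta_z d k) \<noteq> \<lfloor>lambda_dk d k\<rfloor> \<Longrightarrow> 3 \<le> d \<Longrightarrow> excess k mod q = 0"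
proof -
  have q1: "1 \<le> q" using level_bounds(1)[of k] q by (cases q) auto
  obtain c where c: "c \<le> q" "c \<le> 2" "3 \<le> d \<Longrightarrow> c \<le> 1"
    "\<And>n. n \<le> card (layer (q * d)) \<Longrightarrow>
      \<exists>B\<subseteq>layer (q * d). card B = n \<and> (\<forall>i<d. col_sum i B \<le> int (q * n + c))"
    by (rule layer_subset_divisible[OF q1]) blast
  have low: "int (N_p d (level k - 1)) + int n \<le> int (delta_z d k)"
    if n: "n \<le> extra k" "q * n + c \<le> excess k" for n
  proof -
    have "n \<le> card (layer (q * d))" using n(1) extra_less[of k] q by simp
    then obtain B where B: "B \<subseteq> layer (q * d)" "card B = n" "\<forall>i<d. col_sum i B \<le> int (q * n + c)"
      using c(4) by blast
    moreover have "int (q * n + c) \<le> int (excess k)" using n(2) by (simp only: of_nat_le_iff)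
    ultimately have "\<forall>i<d. col_sum i B \<le> int (excess k)" by (meson order.trans)
    then show ?thesis using delta_ge_subset[of B k] B q by simp
  qed
  have ex: "excess k = q * extra k + excess k mod q"
    by (simp add: extra_level_dvd[OF q])
  show "\<lfloor>lambda_dk d k\<rfloor> - 1 \<le> int (delta_z d k)"
  proof (cases "extra k")
    case 0
    then show ?thesis using delta_ge_subset[of "{}" k] by (simp add: floor_lambda col_sum_def)
  next
    case (Suc n)
    then show ?thesis using low[of n] ex c(1) by (simp add: floor_lambda)
  qed
  assume "int (delta_z d k) \<noteq> \<lfloor>lambda_dk d k\<rfloor>"
  then have "\<not> q * extra k + c \<le> excess k"
    using low[of "extra k"] delta_le_floor[of k] by (auto simp: floor_lambda)
  then have "excess k mod q < c" using ex by linarith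
  then show "excess k mod q < 2" "3 \<le> d \<Longrightarrow> excess k mod q = 0" using c by auto
qed

subsection \<open>Exactly balanced sets in dimension at least three\<close>

text \<open>Opposite roots cancel, so these sets are exactly balanced; they realise the even
  sizes.\<close>

definition pairs :: "nat \<Rightarrow> nat \<Rightarrow> int list set" where
  "pairs q a = root_vec q 0 ` {1..a} \<union> (\<lambda>i. root_vec q i 0) ` {1..a}"

lemma pairs_balanced:
  assumes q: "1 \<le> q" and d: "3 \<le> d" and a: "a < d"
  shows "pairs q a \<subseteq> flat_layer (q * d) 2" "card (pairs q a) = 2 * a"
    "\<And>c. c < d \<Longrightarrow> col_sum c (pairs q a) = int (q * (2 * a))"
proof -
  have inj: "inj_on (root_vec q 0) {1..a}" "inj_on (\<lambda>i. root_vec q i 0) {1..a}"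
    by (rule inj_onI; use a in \<open>simp add: root_vec_eq_iff\<close>)+
  have "root_vec q 0 i \<noteq> root_vec q j 0" if "i \<in> {1..a}" "j \<in> {1..a}" for i j
    using that a by (simp add: root_vec_eq_iff)
  then have disj: "root_vec q 0 ` {1..a} \<inter> (\<lambda>i. root_vec q i 0) ` {1..a} = {}" by blast
  show "pairs q a \<subseteq> flat_layer (q * d) 2"
    unfolding pairs_def using a by (auto intro!: root_vec_flat[OF q d])
  show "card (pairs q a) = 2 * a"
    unfolding pairs_def
    by (subst card_Un_disjoint[OF _ _ disj]) (simp_all only: finite_imageI finite_atLeastAtMost card_image inj, simp)
  fix c assume c: "c < d"
  have "col_sum c (pairs q a) = (\<Sum>i=1..a. \<bar>root_vec q 0 i ! c\<bar>) + (\<Sum>i=1..a. \<bar>root_vec q i 0 ! c\<bar>)"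
    unfolding pairs_def col_sum_union[OF finite_imageI finite_imageI disj, OF finite_atLeastAtMost finite_atLeastAtMost]
    by (simp only: col_sum_def sum.reindex inj comp_def)
  also have "\<dots> = (\<Sum>i=1..a. 2 * int q)"
    unfolding sum.distrib[symmetric] using c q by (intro sum.cong) (auto simp: of_bool_def)
  finally show "col_sum c (pairs q a) = int (q * (2 * a))" by simp
qed

text \<open>
  Changing the sign of the last coordinate keeps the triangle disjoint from the pairs, so that their
  unions realise the odd sizes. The first coordinate stays positive.
\<close>

definition flip_last :: "int list \<Rightarrow> int list" where
  "flip_last x = x[d - 1 := - x ! (d - 1)]"

lemma length_flip_last [simp]: "length (flip_last x) = length x"
  by (simp add: flip_last_def)

lemma abs_flip_last: "length x = d \<Longrightarrow> i < d \<Longrightarrow> \<bar>flip_last x ! i\<bar> = \<bar>x ! i\<bar>"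
  by (simp add: flip_last_def nth_list_update)

lemma flip_last_layer:
  assumes "x \<in> layer p" "0 < x ! 0" shows "flip_last x \<in> layer p"
proof -
  have x: "length x = d" "Gcd (set x) = 1" using assms by (auto simp: layer_def prim_posD)
  have "Gcd (set (flip_last x)) dvd Gcd (set x)"
  proof (rule Gcd_greatest)
    fix y assume "y \<in> set x"
    then obtain i where i: "i < d" "y = x ! i" using x by (auto simp: in_set_conv_nth)
    have "Gcd (set (flip_last x)) dvd flip_last x ! i"
      by (rule Gcd_dvd) (use i x in simp)
    then show "Gcd (set (flip_last x)) dvd y"
      using abs_flip_last[OF x(1) i(1)] i(2) by (metis dvd_abs_iff)
  qed
  then have "Gcd (set (flip_last x)) = 1" using x(2) by simp
  moreover have "0 < flip_last x ! 0" using assms(2) d2 by (simp add: flip_last_def)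
  moreover have "norm1 (flip_last x) = norm1 x"
    unfolding norm1_def by (intro sum.cong) (simp_all add: abs_flip_last x)
  ultimately show ?thesis
    using assms(1) x by (simp add: layer_def prim_posI_pos)
qed

text \<open>The three roots e_0 - e_1, e_1 - e_2 and e_2 - e_0 sum to zero, which gives an exactly
  balanced set of size 3.\<close>

definition triangle :: "nat \<Rightarrow> int list set" where
  "triangle q = {flip_last (root_vec q 0 1), flip_last (root_vec q 1 2), flip_last (root_vec q 2 0)}"

lemma flip_last_inj: "length x = d \<Longrightarrow> length y = d \<Longrightarrow> flip_last x = flip_last y \<longleftrightarrow> x = y"
proof -
  assume l: "length x = d" "length y = d"
  have "flip_last (flip_last z) = z" if "length z = d" for z
    using that d2 by (simp add: flip_last_def)
  then show ?thesis using l by metis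
qed

text \<open>For \<open>q\<close> at least 2 all entries of the root vectors are positive, so after
  the flip the last one is strictly negative and the first stays positive.\<close>

lemma triangle_balanced:
  assumes q: "2 \<le> q" and d: "3 \<le> d"
  shows "triangle q \<subseteq> flat_layer (q * d) 2" "card (triangle q) = 3"
    "\<And>c. c < d \<Longrightarrow> col_sum c (triangle q) = int (q * 3)"
    "\<And>x. x \<in> triangle q \<Longrightarrow> x ! (d - 1) < 0"
proof -
  have "flip_last (root_vec q a b) \<in> flat_layer (q * d) 2" if "a < d" "b < d" "a \<noteq> b" for a b
  proof -
    have "0 < root_vec q a b ! 0" using q d by (simp add: of_bool_def)
    then show ?thesis
      using flip_last_layer[OF root_vec_layer[of q a b]] root_vec_flat[of q a b] that q d
      by (simp add: flat_layer_def abs_flip_last)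
  qed
  then show "triangle q \<subseteq> flat_layer (q * d) 2" using d by (simp add: triangle_def)
  have ne: "root_vec q 0 1 \<noteq> root_vec q 1 2" "root_vec q 0 1 \<noteq> root_vec q 2 0" "root_vec q 1 2 \<noteq> root_vec q 2 0"
    using d by (simp_all add: root_vec_eq_iff)
  then show "card (triangle q) = 3" by (simp add: triangle_def flip_last_inj)
  show "col_sum c (triangle q) = int (q * 3)" if c: "c < d" for c
  proof -
    have "col_sum c (triangle q) = \<bar>root_vec q 0 1 ! c\<bar> + \<bar>root_vec q 1 2 ! c\<bar> + \<bar>root_vec q 2 0 ! c\<bar>"
      using ne c by (simp add: triangle_def col_sum_def flip_last_inj abs_flip_last)
    then show ?thesis using c q by (simp add: of_bool_def)
  qed
  have "flip_last (root_vec q a b) ! (d - 1) < 0" for a b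
    using d q by (simp add: flip_last_def of_bool_def)
  then show "x ! (d - 1) < 0" if "x \<in> triangle q" for x
    using that by (auto simp: triangle_def)
qed

lemma balanced_flat_subset:
  assumes q: "2 \<le> q" and d: "3 \<le> d" and j: "2 \<le> j" "j < d + 2"
  obtains A where "A \<subseteq> flat_layer (q * d) 2" "card A = j" "\<And>c. c < d \<Longrightarrow> col_sum c A = int (q * j)"
proof (cases "even j")
  case True
  then obtain a where a: "j = 2 * a" by blast
  then have "a < d" using j d by simp
  then show ?thesis using that[of "pairs q a"] pairs_balanced[of q a] q d a by simp
next
  case False
  then obtain b where b: "j = 2 * b + 1" by (rule oddE)
  then obtain a where a: "j = 2 * a + 3" using j by (cases b) auto
  have ad: "a < d" using a j by simp
  have q1: "1 \<le> q" using q by simp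
  note P = pairs_balanced[OF q1 d ad] and T = triangle_balanced[OF q d]
  have fin: "finite (pairs q a)" "finite (triangle q)" by (simp_all add: pairs_def triangle_def)
  have "0 \<le> x ! (d - 1)" if "x \<in> pairs q a" for x
    using that q d2 by (auto simp: pairs_def of_bool_def)
  then have disj: "pairs q a \<inter> triangle q = {}" using T(4) by force
  show ?thesis
  proof (rule that)
    show "pairs q a \<union> triangle q \<subseteq> flat_layer (q * d) 2" using P(1) T(1) by blast
    show "card (pairs q a \<union> triangle q) = j"
      using card_Un_disjoint[OF fin disj] P(2) T(2) a by simp
    show "col_sum c (pairs q a \<union> triangle q) = int (q * j)" if "c < d" for c
      unfolding col_sum_union[OF fin disj] P(3)[OF that] T(3)[OF that] by (simp add: a algebra_simps)
  qed
qed

text \<open>Orbits are filled up to size \<open>n - 2\<close> rather than \<open>n\<close>, so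
  between 2 and \<open>d + 1\<close> points remain, all sizes covered by
  \<open>balanced_flat_subset\<close>. The upper bound on \<open>n\<close> prevents the orbits
  outside the flat layer from running out.\<close>

lemma balanced_layer_subset:
  assumes q: "2 \<le> q" and d: "3 \<le> d"
    and n: "2 \<le> n" "n + card (flat_layer (q * d) 2) < card (layer (q * d))"
  obtains B where "B \<subseteq> layer (q * d)" "card B = n" "\<And>c. c < d \<Longrightarrow> col_sum c B = int (q * n)"
proof -
  let ?U = "flat_layer (q * d) 2"
  have UL: "?U \<subseteq> layer (q * d)" by (auto simp: flat_layer_def)
  obtain Y where Y: "Y \<subseteq> layer (q * d) - ?U" "rot_closed Y" "card Y \<le> n - 2"
    "n - 2 < card Y + d \<or> Y = layer (q * d) - ?U"
    using rot_closed_subset_of_size[OF rot_closed_layer_diff_flat] by blast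
  have "Y \<noteq> layer (q * d) - ?U"
    using Y(3) n card_Diff_subset[OF finite_flat_layer UL] by auto
  then have j: "2 \<le> n - card Y" "n - card Y < d + 2" using Y(3,4) n(1) by auto
  obtain A where A: "A \<subseteq> ?U" "card A = n - card Y" "\<And>c. c < d \<Longrightarrow> col_sum c A = int (q * (n - card Y))"
    by (rule balanced_flat_subset[OF q d j]) blast
  have fin: "finite Y" "finite A"
    using finite_subset[OF A(1) finite_flat_layer] Y(2) by (auto simp: rot_closed_def)
  have disj: "Y \<inter> A = {}" using Y A by blast
  show ?thesis
  proof (rule that)
    show "Y \<union> A \<subseteq> layer (q * d)" using Y A UL by blast
    show "card (Y \<union> A) = n" using card_Un_disjoint[OF fin disj] A(2) Y(3) n(1) by simp
    fix c assume c: "c < d"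
    have "int d * col_sum c Y = int (q * d) * int (card Y)"
      using rot_closed_layer_col_sum[OF Y(2) _ c] Y(1) by blast
    then have "int d * col_sum c Y = int d * (int q * int (card Y))" by simp
    then have "col_sum c Y = int q * int (card Y)" using d2 by simp
    moreover obtain r where "n = card Y + r" 
      using Y(3) le_Suc_ex[of "card Y" n] by (meson diff_le_self order.trans)
    ultimately show "col_sum c (Y \<union> A) = int (q * n)"
      by (simp add: col_sum_union[OF fin disj] A(3)[OF c] algebra_simps)
  qed
qed

lemma delta_level_dvd_balanced:
  assumes q: "level k = q * d" "2 \<le> q" and d: "3 \<le> d" and ex: "2 \<le> extra k"
    and n: "extra k + card (flat_layer (q * d) 2) < card (layer (q * d))"
  shows "int (delta_z d k) = \<lfloor>lambda_dk d k\<rfloor>"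
proof -
  obtain B where B: "B \<subseteq> layer (q * d)" "card B = extra k" "\<And>c. c < d \<Longrightarrow> col_sum c B = int (q * extra k)"
    by (rule balanced_layer_subset[OF q(2) d ex n]) blast
  have "q * extra k \<le> excess k" by (simp add: extra_level_dvd[OF q(1)])
  then have "col_sum c B \<le> int (excess k)" if "c < d" for c
    unfolding B(3)[OF that] by (simp only: of_nat_le_iff)
  then show ?thesis
    using delta_ge_subset[of B k] B(1,2) q(1) delta_le_floor[of k] by (simp add: floor_lambda)
qed

text \<open>The absolute coordinates average \<open>q\<close> and differ by at most 2, so each lies
  within 2 of \<open>q\<close>. Counting both signs leaves at most 10 values per coordinate.\<close>

lemma card_flat_layer_2_le: "card (flat_layer (q * d) 2) \<le> 10 ^ d"
proof -
  let ?S = "{int q - 2..int q + 2} \<union> {- int q - 2..- int q + 2}"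
  have "flat_layer (q * d) 2 \<subseteq> {x. set x \<subseteq> ?S \<and> length x = d}"
  proof safe
    fix x assume x: "x \<in> flat_layer (q * d) 2"
    then have n: "(\<Sum>b<d. \<bar>x ! b\<bar>) = int q * int d" by (simp add: flat_layer_def layer_def norm1_def)
    show "length x = d" using x by (simp add: flat_layer_def layer_def prim_posD)
    fix y assume "y \<in> set x" and y: "y \<notin> {- int q - 2..- int q + 2}"
    then obtain a where a: "a < d" "y = x ! a"
      using \<open>length x = d\<close> by (auto simp: in_set_conv_nth)
    have "(\<Sum>b<d. \<bar>x ! a\<bar>) \<le> (\<Sum>b<d. \<bar>x ! b\<bar> + 2)" "(\<Sum>b<d. \<bar>x ! b\<bar>) \<le> (\<Sum>b<d. \<bar>x ! a\<bar> + 2)"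
      by (intro sum_mono; use x a in \<open>force simp: flat_layer_def\<close>)+
    then have "int d * \<bar>x ! a\<bar> \<le> int d * (int q + 2)" "int d * int q \<le> int d * (\<bar>x ! a\<bar> + 2)"
      using n by (simp_all add: sum.distrib algebra_simps)
    then have "\<bar>x ! a\<bar> \<le> int q + 2" "int q \<le> \<bar>x ! a\<bar> + 2" using d2 by simp_all
    then show "y \<in> {int q - 2..int q + 2}" using a y by auto
  qed
  then have "card (flat_layer (q * d) 2) \<le> card {x. set x \<subseteq> ?S \<and> length x = d}"
    by (intro card_mono finite_lists_length_eq) auto
  also have "\<dots> = card ?S ^ d" by (rule card_lists_length_eq) simp
  also have "\<dots> \<le> 10 ^ d"
    using card_Un_le[of "{int q - 2..int q + 2}" "{- int q - 2..- int q + 2}"] by (intro power_mono) auto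
  finally show ?thesis .
qed

lemma two_le_card_layer: "3 \<le> p \<Longrightarrow> 2 \<le> card (layer p)"
proof -
  assume p: "3 \<le> p"
  let ?v = "\<lambda>a b. vec (\<lambda>i. (if i = 0 then a else 0) + (if i = 1 then b else 0))"
  have "?v 1 (int p - 1) \<in> layer p" "?v (int p - 1) 1 \<in> layer p"
    by (rule vec_in_layer[of _ 0 1]; use p d2 in \<open>simp add: sum.distrib\<close>)+
  moreover have "?v 1 (int p - 1) \<noteq> ?v (int p - 1) 1"
    using p d2 by (auto dest!: arg_cong[of _ _ "\<lambda>x. x ! 0"])
  ultimately have "card {?v 1 (int p - 1), ?v (int p - 1) 1} \<le> card (layer p)"
    by (intro card_mono finite_layer) auto
  then show ?thesis using \<open>?v 1 (int p - 1) \<noteq> ?v (int p - 1) 1\<close> by simp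
qed

text \<open>One extra point would use the whole budget, so both penalties in
  \<open>packing_excess\<close> vanish: the packing is the ball and one point of norm
  \<open>q * d\<close>. Each column has room for \<open>q\<close> only, which forces all absolute
  coordinates to equal \<open>q\<close>.\<close>

lemma exception_dvd:
  assumes q: "2 \<le> q" and k: "int k = kappa_p d (q * d - 1) + int q"
  shows "int (delta_z d k) \<noteq> \<lfloor>lambda_dk d k\<rfloor>"
proof
  assume eq: "int (delta_z d k) = \<lfloor>lambda_dk d k\<rfloor>"
  let ?p = "q * d" and ?b = "ball_prim d (q * d - 1)"
  have "2 * 2 \<le> q * d" using q d2 by (rule mult_le_mono)
  then have p: "1 \<le> ?p" "3 \<le> ?p" by linarith+
  have lev: "level k = ?p"
  proof (rule level_eqI[OF p(1)])
    have "int d * kappa_p d ?p = int d * (kappa_p d (?p - 1) + int q * int (card (layer ?p)))"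
      using kappa_p_split[OF p(1)] by (simp add: algebra_simps)
    then have "kappa_p d ?p = kappa_p d (?p - 1) + int q * int (card (layer ?p))" using d2 by simp
    \<comment> \<open>A second point in the layer keeps \<open>k\<close> below the next value of
      \<open>kappa_p\<close>.\<close>
    moreover have "int q * 1 < int q * int (card (layer ?p))"
      using two_le_card_layer[OF p(2)] q by (intro mult_strict_left_mono) auto
    ultimately show "int k < kappa_p d ?p" using k by simp
  qed (use k in simp)
  then have ex: "excess k = q" using k by (simp add: excess_def)
  then have "extra k = 1" using q by (simp add: extra_level_dvd[OF lev])
  then have delta: "delta_z d k = N_p d (?p - 1) + 1" using eq lev by (simp add: floor_lambda)
  obtain X where X: "finite X" "X \<subseteq> prim_pos d" "kappa d X \<le> int k" "card X = delta_z d k"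
    by (rule delta_attained)
  let ?S1 = "\<Sum>x\<in>X - ?b. norm1 x - int ?p" and ?S2 = "\<Sum>x\<in>?b - X. int ?p - norm1 x"
  have pos: "\<forall>x\<in>X - ?b. 0 \<le> norm1 x - int ?p" "\<forall>x\<in>?b - X. 0 < int ?p - norm1 x"
    using norm1_outside_ball[OF _ p(1)] norm1_inside_ball[OF p(1)] X(2) by force+
  have "?S1 + ?S2 \<le> 0"
    using packing_excess[OF X(1-3) p(1)] X(4) delta k by (simp add: algebra_simps)
  moreover have "0 \<le> ?S1" "0 \<le> ?S2" using pos by (meson sum_nonneg less_imp_le)+
  ultimately have S: "?S1 = 0" "?S2 = 0" by linarith+
  have "?b \<subseteq> X"
  proof (rule ccontr)
    assume "\<not> ?b \<subseteq> X"
    then have "0 < ?S2" using pos(2) finite_ball by (intro sum_pos) auto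
    then show False using S by simp
  qed
  then have "card (X - ?b) = 1"
    using card_Diff_subset[OF finite_ball] X(4) delta by (simp add: N_p_def)
  then obtain x where x: "X - ?b = {x}" by (rule card_1_singletonE)
  then have X_eq: "X = ?b \<union> {x}" "?b \<inter> {x} = {}" using \<open>?b \<subseteq> X\<close> by auto
  have nx: "norm1 x = int ?p" using S(1) x by simp
  have le: "\<bar>x ! i\<bar> \<le> int q" if "i < d" for i
  proof -
    have "col_sum i X \<le> int k" using X(3) that by (simp add: kappa_le_iff)
    moreover have "col_sum i X = col_sum i ?b + col_sum i {x}"
      unfolding X_eq(1) by (rule col_sum_union[OF finite_ball _ X_eq(2)]) simp
    moreover have "col_sum i {x} = \<bar>x ! i\<bar>" by (simp add: col_sum_def)
    ultimately show ?thesis using k kappa_p_col_sum[OF that, of "?p - 1"] by linarith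
  qed
  have "\<bar>x ! i\<bar> = int q" if i: "i < d" for i
  proof (rule ccontr)
    assume "\<bar>x ! i\<bar> \<noteq> int q"
    then have "\<bar>x ! i\<bar> < int q" using le[OF i] by simp
    then have "(\<Sum>i<d. \<bar>x ! i\<bar>) < (\<Sum>i<d. int q)"
      using le i by (intro sum_strict_mono_ex1) auto
    then show False using nx by (simp add: norm1_def)
  qed
  note xq = this
  have "x \<in> prim_pos d" using x X(2) by blast
  then have "length x = d" "Gcd (set x) = 1" by (simp_all add: prim_posD)
  moreover have "int q dvd y" if "y \<in> set x" for y
    using that xq \<open>length x = d\<close> by (metis abs_dvd_iff dvd_abs_iff dvd_refl in_set_conv_nth)
  then have "int q dvd Gcd (set x)" by (rule Gcd_greatest)
  ultimately show False using q by simp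
qed

subsection \<open>The exceptional set\<close>

definition exceptions :: "nat set" where
  "exceptions = {k. 1 \<le> k \<and> int (delta_z d k) \<noteq> \<lfloor>lambda_dk d k\<rfloor>}"

lemma exceptions_level:
  assumes "k \<in> exceptions" obtains q where "1 \<le> q" "level k = q * d"
proof -
  have "d dvd level k" using delta_level_not_dvd[of k] assms by (auto simp: exceptions_def)
  then obtain q where q: "level k = q * d" by (metis dvd_def mult.commute)
  then have "1 \<le> q" using level_bounds(1)[of k] by (cases q) auto
  then show ?thesis using that q by blast
qed

lemma delta_exceptions:
  assumes "k \<in> exceptions" shows "int (delta_z d k) = \<lfloor>lambda_dk d k\<rfloor> - 1"
proof -
  obtain q where "level k = q * d" using exceptions_level[OF assms] by blast
  then show ?thesis
    using delta_level_dvd(1)[of k q] delta_le_floor[of k] assms by (simp add: exceptions_def)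
qed

lemma infinite_exceptions: "infinite exceptions"
  unfolding infinite_nat_iff_unbounded_le
proof
  fix m
  define q :: nat where "q = m + 2"
  define k where "k = nat (kappa_p d (q * d - 1)) + q"
  have "0 \<le> kappa_p d (q * d - 1)" using kappa_p_mono[of 0 "q * d - 1"] kappa_p_0 by simp
  then have "int k = kappa_p d (q * d - 1) + int q" by (simp add: k_def)
  then have "k \<in> exceptions"
    using exception_dvd[of q k] by (simp add: exceptions_def q_def k_def)
  then show "\<exists>n\<ge>m. n \<in> exceptions" by (intro exI[of _ k]) (simp add: k_def q_def)
qed

section \<open>Counting exceptions and their density\<close>

lemma level_power_le: "((level k - 1) div (2 * d)) ^ d \<le> k"
proof -
  let ?M = "(level k - 1) div (2 * d)"
  have "int ?M ^ d \<le> kappa_p d (2 * d * ?M)" by (rule kappa_p_ge_power)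
  also have "\<dots> \<le> kappa_p d (level k - 1)" by (intro kappa_p_mono) simp
  also have "\<dots> \<le> int k" by (rule level_bounds)
  finally have "int (?M ^ d) \<le> int k" by simp
  then show ?thesis by (simp only: of_nat_le_iff)
qed

lemma level_le_powr:
  "real (level k) \<le> 2 * real d * (real k powr (1 / real d) + 1)"
proof -
  let ?M = "(level k - 1) div (2 * d)"
  have "real ?M ^ d \<le> real k"
    using level_power_le[of k] by (metis of_nat_le_iff of_nat_power)
  then have "(real ?M ^ d) powr (1 / real d) \<le> real k powr (1 / real d)"
    by (intro powr_mono2) auto
  moreover have "(real ?M ^ d) powr (1 / real d) = real ?M"
    using d2 by (cases "?M = 0") (auto simp: powr_realpow[symmetric] powr_powr power_0_left)
  ultimately have M: "real ?M \<le> real k powr (1 / real d)" by simp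
  have "level k - 1 < 2 * d * (?M + 1)"
    using d2 dividend_less_times_div[of "2 * d" "level k - 1"] by simp
  then have "level k \<le> 2 * d * (?M + 1)" using level_bounds(1)[of k] by linarith
  then have "real (level k) \<le> real (2 * d * (?M + 1))" by (simp only: of_nat_le_iff)
  also have "\<dots> = 2 * real d * (real ?M + 1)" by (simp only: of_nat_mult of_nat_add of_nat_numeral of_nat_1)
  also have "\<dots> \<le> 2 * real d * (real k powr (1 / real d) + 1)"
    using M by (intro mult_left_mono) auto
  finally show ?thesis .
qed

text \<open>Levels up to \<open>d\<close>, where \<open>q = 1\<close>, contribute at most
  \<open>kappa_p d d\<close> values. At higher levels \<open>delta_level_dvd_balanced\<close>
  confines \<open>extra k\<close> to a bounded number of values at either end of its range, and
  \<open>excess k\<close> is \<open>q\<close> times \<open>extra k\<close>.\<close>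

lemma exceptions_count_space:
  assumes d: "3 \<le> d"
  shows "card (exceptions \<inter> {1..K}) \<le> nat (kappa_p d d) + (level K + 1) * (10 ^ d + 2)"
proof -
  let ?A = "exceptions \<inter> {1..K} \<inter> {k. level k \<le> d}"
  let ?B = "exceptions \<inter> {1..K} - {k. level k \<le> d}"
  have "?A \<subseteq> {..<nat (kappa_p d d)}"
  proof
    fix k assume "k \<in> ?A"
    then have "int k < kappa_p d d" using level_bounds(2)[of k] kappa_p_mono[of "level k" d] by simp
    then show "k \<in> {..<nat (kappa_p d d)}" by simp
  qed
  then have cA: "card ?A \<le> nat (kappa_p d d)" using card_mono[OF finite_lessThan] by fastforce
  \<comment> \<open>Values 0 and 1 encode the low end. The high end is encoded by the distance to
    the layer size, at least 1 by \<open>extra_less\<close>; adding 1 keeps these codes from 2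
    upwards.\<close>
  define code where "code k = (if extra k < 2 then extra k
    else card (layer (level k)) - extra k + 1)" for k
  have B: "excess k = (level k div d) * extra k \<and> code k < 10 ^ d + 2" if "k \<in> ?B" for k
  proof -
    have ke: "k \<in> exceptions" using that by simp
    obtain q where q: "1 \<le> q" "level k = q * d" by (rule exceptions_level[OF ke]) blast
    have "q \<noteq> 1" using that q(2) by auto
    then have q2: "2 \<le> q" using q by simp
    have ne: "int (delta_z d k) \<noteq> \<lfloor>lambda_dk d k\<rfloor>" using ke by (simp add: exceptions_def)
    have "excess k mod q = 0" by (rule delta_level_dvd(3)[OF q(2) ne d])
    then have "excess k = (level k div d) * extra k"
      using d2 by (auto simp: extra_level_dvd[OF q(2)] q(2))
    moreover have "code k < 10 ^ d + 2"
    proof (cases "extra k < 2")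
      case False
      then have "card (layer (q * d)) \<le> extra k + card (flat_layer (q * d) 2)"
        using delta_level_dvd_balanced[OF q(2) q2 d] ne by force
      then show ?thesis using card_flat_layer_2_le[of q] False q(2) by (simp add: code_def)
    qed (simp add: code_def)
    ultimately show ?thesis by blast
  qed
  have "inj_on (\<lambda>k. (level k, code k)) ?B"
  proof (rule inj_onI)
    fix k l assume kl: "k \<in> ?B" "l \<in> ?B" and "(level k, code k) = (level l, code l)"
    then have eq: "level k = level l" "code k = code l" by auto
    then have "extra k = extra l"
      using extra_less[of k] extra_less[of l] by (auto simp: code_def split: if_splits)
    then have "excess k = excess l" using B[OF kl(1)] B[OF kl(2)] eq by simp
    then show "k = l" using excess_eq[of k] excess_eq[of l] eq by simp
  qed
  moreover have "(\<lambda>k. (level k, code k)) ` ?B \<subseteq> {..level K} \<times> {..<10 ^ d + 2}"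
    using B level_mono by auto
  ultimately have "card ?B \<le> card ({..level K} \<times> {..<10 ^ d + 2 :: nat})"
    by (intro card_inj_on_le) auto
  then have cB: "card ?B \<le> (level K + 1) * (10 ^ d + 2)" by (simp add: card_cartesian_product)
  have "exceptions \<inter> {1..K} = ?A \<union> ?B" by blast
  then have "card (exceptions \<inter> {1..K}) \<le> card ?A + card ?B" using card_Un_le by metis
  then show ?thesis using cA cB by linarith
qed

text \<open>An exception \<open>k\<close> is determined by \<open>\<delta>\<^sub>z(d,k)\<close> and \<open>m mod q \<in> {0, 1}\<close>.\<close>

lemma exceptions_count_delta: "card (exceptions \<inter> {1..K}) \<le> 2 * (delta_z d K + 1)"
proof -
  let ?B = "exceptions \<inter> {1..K}"
  define rest where "rest k = excess k mod (level k div d)" for k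
  have B: "int (delta_z d k) + 1 = int (N_p d (level k - 1)) + int (extra k) \<and>
      excess k = (level k div d) * extra k + rest k \<and> rest k < 2" if "k \<in> ?B" for k
  proof -
    have ke: "k \<in> exceptions" using that by simp
    obtain q where q: "1 \<le> q" "level k = q * d" by (rule exceptions_level[OF ke]) blast
    have ne: "int (delta_z d k) \<noteq> \<lfloor>lambda_dk d k\<rfloor>" using ke by (simp add: exceptions_def)
    have "level k div d = q" using d2 q(2) by simp
    then show ?thesis
      using delta_exceptions[OF ke] delta_level_dvd(2)[OF q(2) ne]
      by (simp add: rest_def floor_lambda extra_level_dvd[OF q(2)])
  qed
  \<comment> \<open>For an exception \<open>delta_z d k + 1\<close> is \<open>N_p\<close> at the
    preceding level plus \<open>extra k\<close>, hence below \<open>N_p\<close> at its own level, so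
    equal values force equal levels.\<close>
  have level_le: "level l \<le> level k" if "k \<in> ?B" "l \<in> ?B" "delta_z d k = delta_z d l" for k l
  proof (rule ccontr)
    assume "\<not> ?thesis"
    then have "N_p d (level k) \<le> N_p d (level l - 1)" by (intro N_p_mono) simp
    moreover have "N_p d (level k) = N_p d (level k - 1) + card (layer (level k))"
      by (rule N_p_split[OF level_bounds(1)])
    ultimately show False using B[OF that(1)] B[OF that(2)] that(3) extra_less[of k] by linarith
  qed
  have "inj_on (\<lambda>k. (delta_z d k, rest k)) ?B"
  proof (rule inj_onI)
    fix k l assume kl: "k \<in> ?B" "l \<in> ?B" and "(delta_z d k, rest k) = (delta_z d l, rest l)"
    then have eq: "delta_z d k = delta_z d l" "rest k = rest l" by auto
    then have lev: "level k = level l" using level_le kl by (simp add: antisym)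
    then have "extra k = extra l" using B[OF kl(1)] B[OF kl(2)] eq(1) by simp
    then have "excess k = excess l" using B[OF kl(1)] B[OF kl(2)] eq lev by simp
    then show "k = l" using excess_eq[of k] excess_eq[of l] lev by simp
  qed
  moreover have "(\<lambda>k. (delta_z d k, rest k)) ` ?B \<subseteq> {..delta_z d K} \<times> {..<2}"
    using B delta_mono by auto
  ultimately have "card ?B \<le> card ({..delta_z d K} \<times> {..<2 :: nat})"
    by (intro card_inj_on_le) auto
  then show ?thesis by (simp add: card_cartesian_product)
qed

text \<open>\<open>delta_upper\<close> holds for every radius, not only the level of
  \<open>k\<close>. Large \<open>T\<close> makes the slope \<open>d / T\<close> arbitrarily small,
  whence sublinear growth.\<close>

lemma delta_le_linear: "1 \<le> T \<Longrightarrow> real (delta_z d k) \<le> real (N_p d (T - 1)) + real d * real k / real T"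
proof -
  assume T: "1 \<le> T"
  have "0 \<le> int d * kappa_p d (T - 1)" using kappa_p_mono[of 0 "T - 1"] kappa_p_0 by simp
  then have "int T * (int (delta_z d k) - int (N_p d (T - 1))) \<le> int d * int k"
    using delta_upper[OF T, of k] by (simp add: algebra_simps)
  then have "real_of_int (int T * (int (delta_z d k) - int (N_p d (T - 1)))) \<le> real_of_int (int d * int k)"
    by (simp only: of_int_le_iff)
  then have "real T * (real (delta_z d k) - real (N_p d (T - 1))) \<le> real d * real k" by simp
  then show ?thesis using T by (simp add: field_simps)
qed

lemma exceptions_density_plane:
  "(\<lambda>k. real (card (exceptions \<inter> {1..k})) / real k) \<longlonglongrightarrow> 0"
proof (rule tendstoI)
  fix e :: real assume e: "0 < e"
  \<comment> \<open>This choice brings the slope \<open>2 * d / T\<close> of the bound on the count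
    below \<open>e / 2\<close>.\<close>
  obtain T :: nat where T: "4 * real d / e < real T" using reals_Archimedean2 by blast
  then have T0: "1 \<le> T" using e by (cases T) (auto simp: field_simps)
  have Te: "2 * real d / real T < e / 2" using T T0 e by (simp add: field_simps)
  define C where "C = 2 * (real (N_p d (T - 1)) + 1)"
  have "(\<lambda>k. C / real k) \<longlonglongrightarrow> 0" by (rule lim_const_over_n)
  then have "\<forall>\<^sub>F k in sequentially. C / real k < e / 2"
    using e by (intro order_tendstoD) auto
  then show "\<forall>\<^sub>F k in sequentially. dist (real (card (exceptions \<inter> {1..k})) / real k) 0 < e"
    using eventually_gt_at_top[of 0]
  proof eventually_elim
    case (elim k)
    have "real (card (exceptions \<inter> {1..k})) \<le> real (2 * (delta_z d k + 1))"
      using exceptions_count_delta by (simp only: of_nat_le_iff)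
    also have "\<dots> \<le> C + 2 * real d * real k / real T"
      using delta_le_linear[OF T0, of k] by (simp add: C_def)
    finally have "real (card (exceptions \<inter> {1..k})) / real k \<le> (C + 2 * real d * real k / real T) / real k"
      by (intro divide_right_mono) auto
    also have "\<dots> = C / real k + 2 * real d / real T" using elim(2) by (simp add: field_simps)
    also have "\<dots> < e" using elim(1) Te by linarith
    finally show ?case by simp
  qed
qed

text \<open>The level, and with it the count, is of order at most \<open>k powr (1 / d)\<close>, and
  \<open>1 / d\<close> is smaller than \<open>1 / (d - 1)\<close>.\<close>

lemma exceptions_density_space:
  assumes d: "3 \<le> d"
  shows "(\<lambda>k. real (card (exceptions \<inter> {1..k})) / real k powr (1 / (real d - 1))) \<longlonglongrightarrow> 0"
proof -
  define C where "C = real (10 ^ d + 2)"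
  define A where "A = real (nat (kappa_p d d)) + (2 * real d + 1) * C"
  define B where "B = 2 * real d * C"
  let ?u = "1 / (real d - 1)"
  have u: "0 < ?u" "1 / real d - ?u < 0" using d by (auto simp: field_simps)
  have bound: "real (card (exceptions \<inter> {1..k})) \<le> A + B * real k powr (1 / real d)" for k
  proof -
    have "real (card (exceptions \<inter> {1..k})) \<le> real (nat (kappa_p d d) + (level k + 1) * (10 ^ d + 2))"
      using exceptions_count_space[OF d] by (simp only: of_nat_le_iff)
    also have "\<dots> = real (nat (kappa_p d d)) + (real (level k) + 1) * C"
      by (simp add: C_def algebra_simps)
    also have "\<dots> \<le> real (nat (kappa_p d d)) + (2 * real d * (real k powr (1 / real d) + 1) + 1) * C"
      using level_le_powr[of k] by (intro add_left_mono mult_right_mono) (auto simp: C_def)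
    also have "\<dots> = A + B * real k powr (1 / real d)"
      by (simp add: A_def B_def algebra_simps)
    finally show ?thesis .
  qed
  have "(\<lambda>k. A * real k powr (- ?u) + B * real k powr (1 / real d - ?u)) \<longlonglongrightarrow> A * 0 + B * 0"
    using u by (intro tendsto_add tendsto_mult tendsto_const tendsto_neg_powr filterlim_real_sequentially) auto
  then have lim: "(\<lambda>k. A * real k powr (- ?u) + B * real k powr (1 / real d - ?u)) \<longlonglongrightarrow> 0" by simp
  show ?thesis
  proof (rule tendsto_sandwich[OF _ _ tendsto_const lim])
    show "\<forall>\<^sub>F k in sequentially. real (card (exceptions \<inter> {1..k})) / real k powr ?u
      \<le> A * real k powr (- ?u) + B * real k powr (1 / real d - ?u)"
    proof (rule always_eventually, rule allI)
      fix k
      have "real (card (exceptions \<inter> {1..k})) / real k powr ?u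
        \<le> (A + B * real k powr (1 / real d)) / real k powr ?u"
        by (intro divide_right_mono bound) simp
      also have "\<dots> = A * real k powr (- ?u) + B * real k powr (1 / real d - ?u)"
        by (simp add: add_divide_distrib powr_minus_divide powr_diff)
      finally show "real (card (exceptions \<inter> {1..k})) / real k powr ?u
        \<le> A * real k powr (- ?u) + B * real k powr (1 / real d - ?u)" .
    qed
  qed simp
qed

lemma exceptions_density:
  "(\<lambda>k. real (card (exceptions \<inter> {1..k})) / real k powr (1 / (real d - 1))) \<longlonglongrightarrow> 0"
proof (cases "d = 2")
  \<comment> \<open>For \<open>d = 2\<close> the exponent \<open>1 / (d - 1)\<close> is 1.\<close>
  case True
  then show ?thesis using exceptions_density_plane by simp
next
  case False
  then show ?thesis using d2 by (intro exceptions_density_space) simp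
qed

end

theorem theorem1p2:
  fixes d :: nat
  assumes "d \<ge> 2"
  shows "\<exists>E :: nat set. infinite E \<and> E \<subseteq> {1..} \<and>
    ((\<lambda>k. real (card (E \<inter> {1..k})) / real k powr (1 / (real d - 1))) \<longlongrightarrow> 0) at_top \<and>
    (\<forall>k. k \<ge> 1 \<and> k \<notin> E \<longrightarrow> int (delta_z d k) = \<lfloor>lambda_dk d k\<rfloor>) \<and>
    (\<forall>k\<in>E. int (delta_z d k) = \<lfloor>lambda_dk d k\<rfloor> - 1)"
proof -
  interpret dimension d by unfold_locales (rule assms)
  show ?thesis
  proof (intro exI[of _ exceptions] conjI ballI)
    show "exceptions \<subseteq> {1..}"
      and "\<forall>k. k \<ge> 1 \<and> k \<notin> exceptions \<longrightarrow> int (delta_z d k) = \<lfloor>lambda_dk d k\<rfloor>"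
      by (auto simp: exceptions_def)
  qed (fact infinite_exceptions exceptions_density delta_exceptions)+
qed

end
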